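(* Let $g^*(\mathbf{z})=\sum_{\beta\in\mathbb{N}^n}g^*_\beta\mathbf{z}^\beta\in\mathbb{R}[\mathbf{z}]$ be a real polynomial, let $\Gamma=\{\beta\in\mathbb{N}^n: g^*_\beta\neq 0\}$ and $r=|\Gamma|$. Let $\varphi\in\mathbb{T}^n$ be either of the form $\varphi=(e^{2i\pi/N},\ldots,e^{2i\pi/N})$ with $N$ an integer satisfying $N>\max_{1\le i\le n}\max\{\beta_i:\beta\in\Gamma\}$, or of the form $\varphi=(e^{2i\pi\theta_1},\ldots,e^{2i\pi\theta_n})$ with $\theta_1,\ldots,\theta_n\in\mathbb{R}\setminus\mathbb{N}$ such that $\varphi^\alpha\neq\varphi^\beta$ for all distinct $\alpha,\beta\in\mathbb{Z}^n$. For $\mathfrak{d}\in\mathbb{N}$ let $\sigma_\alpha=g^*(\varphi^\alpha)$ for $\alpha\in\mathscr{A}^1_{\mathfrak{d}}$, and let $\delta=\mathcal{E}(\{\varphi^\beta:\beta\in\Gamma\})$. Then there is a constant $C>0$, depending only on $r$, such that if $\mathfrak{d}\ge C\delta$ then: (1) the problem $$\rho_{\mathfrak{d}}=\inf_{\mu\in\mathscr{M}(\mathbb{T}^n)}\Big\{\|\mu\|_{TV}:\int_{\mathbb{T}^n}\mathbf{z}^\alpha\,d\mu(\mathbf{z})=\sigma_\alpha,\ \alpha\in\mathscr{A}^1_{\mathfrak{d}}\Big\}$$ has a unique optimal solution $\mu^*$, namely $\mu^*=\sum_{\beta\in\Gamma}g^*_\beta\,\delta_{\varphi^\beta}$, and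 $\|\mu^*\|_{TV}=\sum_\beta|g^*_\beta|$; (2) $\rho_{\mathfrak{d}}=\rho^*_{\mathfrak{d}}$, where $$\rho^*_{\mathfrak{d}}=\sup\Big\{\Re\Big(\sum_{\alpha\in\mathscr{A}^1_{\mathfrak{d}}}\sigma_\alpha f_\alpha\Big): f=\sum_{\alpha\in\mathscr{A}^1_{\mathfrak{d}}}f_\alpha\mathbf{z}^\alpha,\ f_\alpha\in\mathbb{C},\ \sup_{\mathbf{z}\in\mathbb{T}^n}|\Re(f(\mathbf{z}))|\le 1\Big\};$$ (3) this dual problem has an optimal solution $f^*$, and for every $\beta\in\Gamma$: if $g^*_\beta>0$ then $\Re(f^*(\varphi^\beta))=1$, and if $g^*_\beta<0$ then $\Re(f^*(\varphi^\beta))=-1$.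
   Context: $\mathbb{T}^n=\{\mathbf{z}\in\mathbb{C}^n: |z_1|=\cdots=|z_n|=1\}$; for $\alpha\in\mathbb{Z}^n$, $\mathbf{z}^\alpha=z_1^{\alpha_1}\cdots z_n^{\alpha_n}$, $\|\alpha\|_1=\sum_i|\alpha_i|$, and $\mathscr{A}^1_{\mathfrak{d}}=\{\alpha\in\mathbb{Z}^n:\|\alpha\|_1\le\mathfrak{d}\}$. $\mathscr{M}(\mathbb{T}^n)$ is the space of finite signed (real-valued) Borel measures on $\mathbb{T}^n$ with total variation norm $\|\cdot\|_{TV}$; $\delta_\xi$ is the Dirac measure at $\xi$. For $d\in\mathbb{N}$, $\mathbb{A}_d$ is the complex vector space of Laurent polynomials $\sum_{\alpha\in\mathscr{A}^1_d}c_\alpha\mathbf{z}^\alpha$. For a set $\Xi=\{\xi_1,\ldots,\xi_r\}\subset\mathbb{T}^n$ of $r$ distinct points, a family of interpolation polynomials is $u_1,\ldots,u_r\in\mathbb{A}_{r-1}$ with $u_i(\xi_j)=\delta_{ij}$, and the interpolation entropy $\mathcal{E}(\Xi)$ is the lowest value of $\max_i\max_{\mathbf{z}\in\mathbb{T}^n}|u_i(\mathbf{z})|^2$ over all such families. *)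

theory Defs
  imports "HOL-Analysis.Analysis"
begin

text \<open>Points of T^n are represented as functions nat => complex that vanish at
indices >= n; multi-indices as functions nat => int (or nat => nat) that vanish
at indices >= n.  The dimension n is an explicit natural number, so that the
constant C can be chosen independently of n.\<close>

definition torus :: "nat \<Rightarrow> (nat \<Rightarrow> complex) set" where
  "torus n = {z. (\<forall>i<n. cmod (z i) = 1) \<and> (\<forall>i\<ge>n. z i = 0)}"

definition torus_space :: "nat \<Rightarrow> (nat \<Rightarrow> complex) measure" where
  "torus_space n = restrict_space borel (torus n)"

definition zmultiidx :: "nat \<Rightarrow> (nat \<Rightarrow> int) set" where
  "zmultiidx n = {\<alpha>. \<forall>i\<ge>n. \<alpha> i = 0}"

definition nmultiidx :: "nat \<Rightarrow> (nat \<Rightarrow> nat) set" where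
  "nmultiidx n = {\<beta>. \<forall>i\<ge>n. \<beta> i = 0}"

definition A1 :: "nat \<Rightarrow> nat \<Rightarrow> (nat \<Rightarrow> int) set" where
  "A1 n d = {\<alpha> \<in> zmultiidx n. (\<Sum>i<n. \<bar>\<alpha> i\<bar>) \<le> int d}"

definition monom :: "nat \<Rightarrow> (nat \<Rightarrow> complex) \<Rightarrow> (nat \<Rightarrow> int) \<Rightarrow> complex" where
  "monom n z \<alpha> = (\<Prod>i<n. (z i) powi (\<alpha> i))"

definition ptpow :: "nat \<Rightarrow> (nat \<Rightarrow> complex) \<Rightarrow> (nat \<Rightarrow> int) \<Rightarrow> (nat \<Rightarrow> complex)" where
  "ptpow n \<phi> \<alpha> = (\<lambda>i. if i < n then (\<phi> i) powi (\<alpha> i) else 0)"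

definition laurent_eval :: "nat \<Rightarrow> nat \<Rightarrow> ((nat \<Rightarrow> int) \<Rightarrow> complex) \<Rightarrow> (nat \<Rightarrow> complex) \<Rightarrow> complex" where
  "laurent_eval n d c z = (\<Sum>\<alpha>\<in>A1 n d. c \<alpha> * monom n z \<alpha>)"

text \<open>A real polynomial given by its finitely supported coefficients g (on N^n).\<close>
definition coeff_support :: "((nat \<Rightarrow> nat) \<Rightarrow> real) \<Rightarrow> (nat \<Rightarrow> nat) set" where
  "coeff_support g = {\<beta>. g \<beta> \<noteq> 0}"

definition poly_eval :: "nat \<Rightarrow> ((nat \<Rightarrow> nat) \<Rightarrow> real) \<Rightarrow> (nat \<Rightarrow> complex) \<Rightarrow> complex" where
  "poly_eval n g z = (\<Sum>\<beta>\<in>coeff_support g. complex_of_real (g \<beta>) * monom n z (int \<circ> \<beta>))"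

definition interp_family :: "nat \<Rightarrow> (nat \<Rightarrow> complex) set \<Rightarrow>
    ((nat \<Rightarrow> complex) \<Rightarrow> (nat \<Rightarrow> int) \<Rightarrow> complex) \<Rightarrow> bool" where
  "interp_family n \<Xi> u \<longleftrightarrow>
     (\<forall>\<xi>\<in>\<Xi>. \<forall>\<eta>\<in>\<Xi>. laurent_eval n (card \<Xi> - 1) (u \<xi>) \<eta> = (if \<xi> = \<eta> then 1 else 0))"

definition interp_entropy :: "nat \<Rightarrow> (nat \<Rightarrow> complex) set \<Rightarrow> real" where
  "interp_entropy n \<Xi> =
     Inf {(SUP \<xi>\<in>\<Xi>. (SUP z\<in>torus n. (cmod (laurent_eval n (card \<Xi> - 1) (u \<xi>) z))\<^sup>2)) | u.
            interp_family n \<Xi> u}"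

definition signed_measure :: "'a measure \<Rightarrow> ('a set \<Rightarrow> real) \<Rightarrow> bool" where
  "signed_measure M \<nu> \<longleftrightarrow>
     \<nu> {} = 0 \<and> (\<forall>A. A \<notin> sets M \<longrightarrow> \<nu> A = 0) \<and>
     (\<forall>A::nat \<Rightarrow> 'a set. range A \<subseteq> sets M \<longrightarrow> disjoint_family A \<longrightarrow>
         (\<lambda>i. \<nu> (A i)) sums \<nu> (\<Union>i. A i))"

definition tv_norm :: "'a measure \<Rightarrow> ('a set \<Rightarrow> real) \<Rightarrow> real" where
  "tv_norm M \<nu> = (SUP P\<in>{P. finite P \<and> P \<subseteq> sets M \<and> disjoint P}. \<Sum>A\<in>P. \<bar>\<nu> A\<bar>)"

definition pos_variation :: "'a measure \<Rightarrow> ('a set \<Rightarrow> real) \<Rightarrow> 'a measure" where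
  "pos_variation M \<nu> = measure_of (space M) (sets M)
      (\<lambda>A. ennreal (SUP B\<in>{B\<in>sets M. B \<subseteq> A}. \<nu> B))"

definition neg_variation :: "'a measure \<Rightarrow> ('a set \<Rightarrow> real) \<Rightarrow> 'a measure" where
  "neg_variation M \<nu> = pos_variation M (\<lambda>A. - \<nu> A)"

definition signed_integral :: "'a measure \<Rightarrow> ('a set \<Rightarrow> real) \<Rightarrow> ('a \<Rightarrow> complex) \<Rightarrow> complex" where
  "signed_integral M \<nu> f = integral\<^sup>L (pos_variation M \<nu>) f - integral\<^sup>L (neg_variation M \<nu>) f"

definition dirac_comb :: "nat \<Rightarrow> (nat \<Rightarrow> complex) \<Rightarrow> ((nat \<Rightarrow> nat) \<Rightarrow> real) \<Rightarrow> (nat \<Rightarrow> complex) set \<Rightarrow> real" where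
  "dirac_comb n \<phi> g A =
     (if A \<in> sets (torus_space n)
      then (\<Sum>\<beta>\<in>coeff_support g. if ptpow n \<phi> (int \<circ> \<beta>) \<in> A then g \<beta> else 0)
      else 0)"

definition moments :: "nat \<Rightarrow> (nat \<Rightarrow> complex) \<Rightarrow> ((nat \<Rightarrow> nat) \<Rightarrow> real) \<Rightarrow> (nat \<Rightarrow> int) \<Rightarrow> complex" where
  "moments n \<phi> g \<alpha> = poly_eval n g (ptpow n \<phi> \<alpha>)"

definition primal_feasible :: "nat \<Rightarrow> nat \<Rightarrow> ((nat \<Rightarrow> int) \<Rightarrow> complex) \<Rightarrow> ((nat \<Rightarrow> complex) set \<Rightarrow> real) \<Rightarrow> bool" where
  "primal_feasible n d \<sigma> \<mu> \<longleftrightarrow> signed_measure (torus_space n) \<mu> \<and>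
     (\<forall>\<alpha>\<in>A1 n d. signed_integral (torus_space n) \<mu> (\<lambda>z. monom n z \<alpha>) = \<sigma> \<alpha>)"

definition primal_value :: "nat \<Rightarrow> nat \<Rightarrow> ((nat \<Rightarrow> int) \<Rightarrow> complex) \<Rightarrow> real" where
  "primal_value n d \<sigma> = Inf {tv_norm (torus_space n) \<mu> | \<mu>. primal_feasible n d \<sigma> \<mu>}"

definition dual_feasible :: "nat \<Rightarrow> nat \<Rightarrow> ((nat \<Rightarrow> int) \<Rightarrow> complex) \<Rightarrow> bool" where
  "dual_feasible n d f \<longleftrightarrow> (\<forall>z\<in>torus n. \<bar>Re (laurent_eval n d f z)\<bar> \<le> 1)"

definition dual_objective :: "nat \<Rightarrow> nat \<Rightarrow> ((nat \<Rightarrow> int) \<Rightarrow> complex) \<Rightarrow> ((nat \<Rightarrow> int) \<Rightarrow> complex) \<Rightarrow> real" where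
  "dual_objective n d \<sigma> f = Re (\<Sum>\<alpha>\<in>A1 n d. \<sigma> \<alpha> * f \<alpha>)"

definition dual_value :: "nat \<Rightarrow> nat \<Rightarrow> ((nat \<Rightarrow> int) \<Rightarrow> complex) \<Rightarrow> real" where
  "dual_value n d \<sigma> = Sup {dual_objective n d \<sigma> f | f. dual_feasible n d f}"

end

theory Submission
  imports Defs
begin

text \<open>
  Let \<open>\<xi>\<^sub>1, \<dots>, \<xi>\<^sub>r\<close> be the nodes, \<open>u\<^sub>i\<close> interpolation polynomials with \<open>\<bar>u\<^sub>i\<bar>\<^sup>2 \<le> 2\<delta>\<close>, and \<open>\<epsilon>\<^sub>i\<close> the sign of the
  coefficient at \<open>\<xi>\<^sub>i\<close>.  The real trigonometric polynomial \<open>w = Re (\<Sum>\<^sub>i \<epsilon>\<^sub>i u\<^sub>i)\<close> takes the values \<open>\<epsilon>\<^sub>i\<close> at the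
  nodes and is bounded by \<open>B = r \<surd>(2\<delta>)\<close>.  A rescaled Chebyshev polynomial of odd degree \<open>O(B)\<close> fixes
  \<open>1\<close> and \<open>-1\<close> and maps \<open>[-B, B]\<close> into \<open>[-1, 1]\<close>; composing it with \<open>w\<close> and multiplying by a trigonometric
  polynomial with values in \<open>[0, 1]\<close> that equals 1 exactly at the nodes gives a dual certificate of
  degree \<open>O(r\<^sup>2 \<delta>)\<close> whose absolute value is 1 only at the nodes.  Weak duality then yields optimality,
  and complementary slackness confines every optimal measure to the nodes, where the moments of the
  \<open>u\<^sub>i\<close> determine its weights.
\<close>

section \<open>Trigonometric polynomials\<close>

lemma finite_A1: "finite (A1 n d)"
proof (rule finite_subset)
  show "A1 n d \<subseteq> {f. \<forall>x. (x \<in> {..<n} \<longrightarrow> f x \<in> {- int d..int d}) \<and> (x \<notin> {..<n} \<longrightarrow> f x = 0)}"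
  proof
    fix \<alpha> assume a: "\<alpha> \<in> A1 n d"
    have "\<bar>\<alpha> x\<bar> \<le> int d" if "x < n" for x
      using a member_le_sum[of x "{..<n}" "\<lambda>i. \<bar>\<alpha> i\<bar>"] that by (auto simp: A1_def)
    then show "\<alpha> \<in> {f. \<forall>x. (x \<in> {..<n} \<longrightarrow> f x \<in> {- int d..int d}) \<and> (x \<notin> {..<n} \<longrightarrow> f x = 0)}"
      using a by (force simp: A1_def zmultiidx_def)
  qed
  show "finite {f. \<forall>x. (x \<in> {..<n} \<longrightarrow> f x \<in> {- int d..int d}) \<and> (x \<notin> {..<n} \<longrightarrow> f x = (0::int))}"
    by (rule finite_set_of_finite_funs) auto
qed

lemma A1_mono: "d \<le> d' \<Longrightarrow> A1 n d \<subseteq> A1 n d'"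
  by (auto simp: A1_def)

lemma A1_zero: "(\<lambda>i. 0) \<in> A1 n d"
  by (auto simp: A1_def zmultiidx_def)

lemma A1_add:
  assumes "\<alpha> \<in> A1 n d" "\<beta> \<in> A1 n e"
  shows "(\<lambda>i. \<alpha> i + \<beta> i) \<in> A1 n (d + e)"
proof -
  have "(\<Sum>i<n. \<bar>\<alpha> i + \<beta> i\<bar>) \<le> (\<Sum>i<n. \<bar>\<alpha> i\<bar> + \<bar>\<beta> i\<bar>)"
    by (intro sum_mono) auto
  then show ?thesis using assms by (auto simp: A1_def zmultiidx_def sum.distrib)
qed

lemma A1_uminus: "\<alpha> \<in> A1 n d \<Longrightarrow> (\<lambda>i. - \<alpha> i) \<in> A1 n d"
  by (auto simp: A1_def zmultiidx_def)

lemma monom_add: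
  assumes "z \<in> torus n"
  shows "monom n z (\<lambda>i. \<alpha> i + \<beta> i) = monom n z \<alpha> * monom n z \<beta>"
proof -
  have "z i \<noteq> 0" if "i < n" for i using assms that by (auto simp: torus_def)
  then show ?thesis by (simp add: monom_def power_int_add prod.distrib)
qed

lemma cnj_monom:
  assumes "z \<in> torus n"
  shows "cnj (monom n z \<alpha>) = monom n z (\<lambda>i. - \<alpha> i)"
proof -
  have "cnj (z i powi k) = z i powi (- k)" if "i < n" for i k
  proof -
    have "cmod (z i) = 1" using assms that by (auto simp: torus_def)
    then have "cmod (z i powi k) = 1" by (simp add: norm_power_int)
    then have "cnj (z i powi k) = inverse (z i powi k)"
      by (metis complex_norm_square inverse_unique mult.commute of_real_1 one_power2)
    then show ?thesis by (simp add: power_int_minus)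
  qed
  then show ?thesis by (simp add: monom_def)
qed

lemma norm_monom: "z \<in> torus n \<Longrightarrow> cmod (monom n z \<alpha>) = 1"
  by (simp add: monom_def torus_def prod_norm[symmetric] norm_power_int)

text \<open>Agreement is asked only on the torus: there monomials multiply and conjugation negates
  exponents, so the class is closed under products, \<open>cnj\<close> and real parts.
  \<open>d\<close> bounds the 1-norm degree from above and need not be attained.\<close>

definition trig_poly :: "nat \<Rightarrow> nat \<Rightarrow> ((nat \<Rightarrow> complex) \<Rightarrow> complex) \<Rightarrow> bool" where
  "trig_poly n d F \<longleftrightarrow> (\<exists>c. \<forall>z\<in>torus n. F z = laurent_eval n d c z)"

lemma trig_poly_laurent_eval: "trig_poly n d (laurent_eval n d c)"
  by (auto simp: trig_poly_def)

lemma trig_poly_cong: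
  "trig_poly n d F \<Longrightarrow> (\<And>z. z \<in> torus n \<Longrightarrow> F z = G z) \<Longrightarrow> trig_poly n d G"
  by (auto simp: trig_poly_def)

lemma trig_poly_monom:
  assumes "\<alpha> \<in> A1 n d"
  shows "trig_poly n d (\<lambda>z. monom n z \<alpha>)"
  unfolding trig_poly_def laurent_eval_def
proof (intro exI ballI)
  fix z
  have "(\<Sum>\<beta>\<in>A1 n d. (if \<beta> = \<alpha> then 1 else 0) * monom n z \<beta>)
      = (\<Sum>\<beta>\<in>A1 n d. if \<beta> = \<alpha> then monom n z \<beta> else 0)"
    by (intro sum.cong) auto
  then show "monom n z \<alpha> = (\<Sum>\<beta>\<in>A1 n d. (if \<beta> = \<alpha> then 1 else 0) * monom n z \<beta>)"
    using assms finite_A1 by simp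
qed

lemma trig_poly_scale:
  assumes "trig_poly n d F"
  shows "trig_poly n d (\<lambda>z. a * F z)"
proof -
  obtain c where c: "\<forall>z\<in>torus n. F z = laurent_eval n d c z"
    using assms by (auto simp: trig_poly_def)
  have "\<forall>z\<in>torus n. a * F z = laurent_eval n d (\<lambda>\<alpha>. a * c \<alpha>) z"
    using c by (simp add: laurent_eval_def sum_distrib_left mult.assoc)
  then show ?thesis unfolding trig_poly_def by blast
qed

lemma trig_poly_add:
  assumes "trig_poly n d F" "trig_poly n d G"
  shows "trig_poly n d (\<lambda>z. F z + G z)"
proof -
  obtain c e where "\<forall>z\<in>torus n. F z = laurent_eval n d c z" "\<forall>z\<in>torus n. G z = laurent_eval n d e z"
    using assms by (auto simp: trig_poly_def)
  then have "\<forall>z\<in>torus n. F z + G z = laurent_eval n d (\<lambda>\<alpha>. c \<alpha> + e \<alpha>) z"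
    by (simp add: laurent_eval_def sum.distrib distrib_right)
  then show ?thesis unfolding trig_poly_def by blast
qed

lemma trig_poly_const: "trig_poly n d (\<lambda>z. a)"
  using trig_poly_scale[OF trig_poly_monom[OF A1_zero], of n d a] by (simp add: monom_def)

lemma trig_poly_diff:
  "trig_poly n d F \<Longrightarrow> trig_poly n d G \<Longrightarrow> trig_poly n d (\<lambda>z. F z - G z)"
  using trig_poly_add[of n d F "\<lambda>z. (-1) * G z"] trig_poly_scale[of n d G "-1"] by simp

lemma trig_poly_sum:
  "(\<And>i. i \<in> I \<Longrightarrow> trig_poly n d (F i)) \<Longrightarrow> trig_poly n d (\<lambda>z. \<Sum>i\<in>I. F i z)"
  by (induction I rule: infinite_finite_induct) (auto intro: trig_poly_const trig_poly_add)

lemma trig_poly_mono: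
  assumes "trig_poly n d F" "d \<le> e"
  shows "trig_poly n e F"
proof -
  obtain c where c: "\<forall>z\<in>torus n. F z = laurent_eval n d c z"
    using assms by (auto simp: trig_poly_def)
  have "trig_poly n e (\<lambda>z. \<Sum>\<alpha>\<in>A1 n d. c \<alpha> * monom n z \<alpha>)"
    using A1_mono[OF assms(2)] by (intro trig_poly_sum trig_poly_scale trig_poly_monom) auto
  then show ?thesis
    using c by (auto elim!: trig_poly_cong simp: laurent_eval_def)
qed

lemma trig_poly_mult:
  assumes "trig_poly n d F" "trig_poly n e G"
  shows "trig_poly n (d + e) (\<lambda>z. F z * G z)"
proof -
  obtain a b where a: "\<forall>z\<in>torus n. F z = laurent_eval n d a z"
    and b: "\<forall>z\<in>torus n. G z = laurent_eval n e b z"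
    using assms by (auto simp: trig_poly_def)
  have "trig_poly n (d + e)
      (\<lambda>z. \<Sum>\<alpha>\<in>A1 n d. \<Sum>\<beta>\<in>A1 n e. (a \<alpha> * b \<beta>) * monom n z (\<lambda>i. \<alpha> i + \<beta> i))"
    by (intro trig_poly_sum trig_poly_scale trig_poly_monom A1_add)
  then show ?thesis
    using a b by (elim trig_poly_cong) (simp add: laurent_eval_def sum_product monom_add mult_ac)
qed

lemma trig_poly_cnj:
  assumes "trig_poly n d F"
  shows "trig_poly n d (\<lambda>z. cnj (F z))"
proof -
  obtain c where c: "\<forall>z\<in>torus n. F z = laurent_eval n d c z"
    using assms by (auto simp: trig_poly_def)
  have "trig_poly n d (\<lambda>z. \<Sum>\<alpha>\<in>A1 n d. cnj (c \<alpha>) * monom n z (\<lambda>i. - \<alpha> i))"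
    by (intro trig_poly_sum trig_poly_scale trig_poly_monom A1_uminus)
  then show ?thesis
    using c by (elim trig_poly_cong) (simp add: laurent_eval_def cnj_monom)
qed

lemma trig_poly_prod:
  assumes "\<And>i. i \<in> I \<Longrightarrow> trig_poly n d (F i)"
  shows "trig_poly n (d * card I) (\<lambda>z. \<Prod>i\<in>I. F i z)"
  using assms
proof (induction I rule: infinite_finite_induct)
  case (insert i I)
  then have "trig_poly n (d + d * card I) (\<lambda>z. F i z * (\<Prod>i\<in>I. F i z))"
    by (intro trig_poly_mult) auto
  then show ?case using insert by simp
qed (auto intro: trig_poly_const)

lemma trig_poly_coordinate:
  assumes "k < n"
  shows "trig_poly n 1 (\<lambda>z. z k)"
proof -
  have m: "(\<lambda>i. if i = k then 1 else 0) \<in> A1 n 1"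
    using assms by (auto simp: A1_def zmultiidx_def if_distrib cong: if_cong)
  have "monom n z (\<lambda>i. if i = k then 1 else 0) = z k" for z
  proof -
    have "monom n z (\<lambda>i. if i = k then 1 else 0) = (\<Prod>i<n. if i = k then z i else 1)"
      unfolding monom_def by (intro prod.cong) auto
    then show ?thesis using assms by simp
  qed
  then show ?thesis using trig_poly_monom[OF m] by simp
qed

lemma trig_poly_Re:
  assumes "trig_poly n d F"
  shows "trig_poly n d (\<lambda>z. of_real (Re (F z)))"
proof -
  have "trig_poly n d (\<lambda>z. (1/2) * (F z + cnj (F z)))"
    using assms by (intro trig_poly_scale trig_poly_add trig_poly_cnj)
  then show ?thesis by (simp add: complex_add_cnj)
qed

text \<open>A crude bound that serves twice: the suprema in the entropy are taken over bounded sets,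
  and Laurent polynomials are integrable against finite measures.\<close>

lemma laurent_eval_bound:
  "z \<in> torus n \<Longrightarrow> cmod (laurent_eval n d c z) \<le> (\<Sum>\<alpha>\<in>A1 n d. cmod (c \<alpha>))"
  unfolding laurent_eval_def
  by (rule order_trans[OF norm_sum]) (simp add: norm_mult norm_monom)

section \<open>Chebyshev polynomials\<close>

text \<open>Chebyshev polynomials of the first kind. The type is general because sizes are estimated
  over the reals while degrees are counted for complex-valued functions;
  \<open>chebyshev_of_real\<close> joins the two.\<close>

fun chebyshev :: "nat \<Rightarrow> 'a \<Rightarrow> 'a::comm_ring_1" where
  "chebyshev 0 x = 1"
| "chebyshev (Suc 0) x = x"
| "chebyshev (Suc (Suc k)) x = 2 * x * chebyshev (Suc k) x - chebyshev k x"

text \<open>The recursion is the identity cos(a + t) + cos(a - t) = 2 cos t cos a with a = (k + 1)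
  t.\<close>

lemma chebyshev_cos: "chebyshev k (cos t) = cos (real k * t)"
proof (induction k "cos t" rule: chebyshev.induct)
  case (3 k)
  have "cos (real (Suc (Suc k)) * t) + cos (real k * t) = 2 * cos t * cos (real (Suc k) * t)"
    using cos_add[of "real (Suc k) * t" t] cos_diff[of "real (Suc k) * t" t]
    by (simp add: algebra_simps)
  then show ?case using 3 by simp
qed auto

lemma chebyshev_bound: "\<bar>x\<bar> \<le> 1 \<Longrightarrow> \<bar>chebyshev k x\<bar> \<le> (1::real)"
  using chebyshev_cos[of k "arccos x"] by (simp add: cos_arccos_abs)

lemma chebyshev_minus: "chebyshev k (- x) = (-1) ^ k * chebyshev k x"
  by (induction k x rule: chebyshev.induct) (auto simp: algebra_simps)

lemma chebyshev_of_real: "chebyshev k (of_real x) = (of_real (chebyshev k x) :: complex)"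
  by (induction k x rule: chebyshev.induct) auto

lemma trig_poly_chebyshev:
  assumes "trig_poly n d F"
  shows "trig_poly n (k * d) (\<lambda>z. chebyshev k (F z))"
proof (induction k rule: less_induct)
  case (less k)
  consider "k = 0" | "k = 1" | j where "k = Suc (Suc j)"
    by (metis One_nat_def not0_implies_Suc)
  then show ?case
  proof cases
    case 3
    have "trig_poly n (d + Suc j * d) (\<lambda>z. (2 * F z) * chebyshev (Suc j) (F z))"
      using less[of "Suc j"] 3 assms by (intro trig_poly_mult trig_poly_scale) auto
    moreover have "trig_poly n (d + Suc j * d) (\<lambda>z. chebyshev j (F z))"
      by (rule trig_poly_mono[of n "j * d"]) (use less[of j] 3 in auto)
    ultimately show ?thesis using trig_poly_diff 3 by force
  qed (use assms trig_poly_const in auto)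
qed

text \<open>For \<open>N = 4k + 1\<close> the extremal point \<open>c = cos (2\<pi>k/N) = sin (\<pi>/(2N))\<close> of the Chebyshev polynomial
  \<open>T\<^sub>N\<close> is at most \<open>1/B\<close> as soon as \<open>k \<ge> B\<close>; hence \<open>x \<mapsto> T\<^sub>N (c x)\<close> is bounded by 1 on \<open>[-B, B]\<close>.\<close>

lemma chebyshev_peak:
  fixes B :: real
  assumes "B \<ge> 1"
  obtains N c where "real N \<le> 9 * B" "0 \<le> c" "c * B \<le> 1"
    "chebyshev N c = (1::real)" "chebyshev N (- c) = (-1::real)"
proof -
  define k where "k = nat \<lceil>B\<rceil>"
  define N where "N = 4 * k + 1"
  define c where "c = cos (2 * pi * real k / real N)"
  have k: "B \<le> real k" "real k \<le> B + 1" using assms unfolding k_def by linarith+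
  have N: "real N > 0" by (simp add: N_def)
  have "2 * pi * real k / real N = pi / 2 - pi / (2 * real N)"
    using N by (simp add: field_simps) (simp add: N_def algebra_simps)
  then have c: "c = sin (pi / (2 * real N))" by (simp add: c_def cos_diff)
  have "pi / (2 * real N) \<le> pi" using N by (simp add: field_simps N_def)
  then have "0 \<le> c" unfolding c by (intro sin_ge_zero) auto
  moreover have "c \<le> pi / (2 * real N)" unfolding c by (rule sin_x_le_x) auto
  then have "c * B \<le> pi / (2 * real N) * B" using assms by (intro mult_right_mono) auto
  then have "c * B \<le> 1"
  proof (rule order_trans)
    \<comment> \<open>With \<open>B \<le> k\<close> this continues to 4 k < N, well below the 2 N
      that is needed.\<close>
    have "pi * B \<le> 4 * B" using pi_less_4 assms by (intro mult_right_mono) auto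
    moreover have "real N = 4 * real k + 1" by (simp add: N_def)
    ultimately have "pi * B \<le> 2 * real N" using k by linarith
    then show "pi / (2 * real N) * B \<le> 1" using N by (simp add: field_simps)
  qed
  moreover have 1: "chebyshev N c = 1"
    using N cos_int_2pin[of "int k"] by (simp add: c_def chebyshev_cos)
  \<comment> \<open>\<open>N\<close> is odd, hence so is the polynomial.\<close>
  moreover have "chebyshev N (- c) = -1" using 1 by (simp add: chebyshev_minus N_def)
  \<comment> \<open>N = 4 k + 1 is at most 4 B + 5, and B is at least 1.\<close>
  moreover have "real N \<le> 9 * B" using k assms by (simp add: N_def)
  ultimately show ?thesis using that by blast
qed

section \<open>The dual certificate\<close>

lemma torus_eqI:
  assumes "z \<in> torus n" "w \<in> torus n" "\<And>k. k < n \<Longrightarrow> z k = w k"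
  shows "z = w"
proof
  fix k show "z k = w k"
    using assms by (cases "k < n") (auto simp: torus_def)
qed

text \<open>\<open>H\<close> is 1 minus a product of scaled squared distances to the nodes: each
  factor lies in [0, 1] and vanishes at its own node only. A squared distance is a sum of products
  of a linear form with its conjugate, hence of degree 2. Multiplying by \<open>H\<close> will make
  the certificate strictly smaller than 1 off the nodes.\<close>

lemma trig_poly_indicator:
  assumes "finite \<Xi>" "\<Xi> \<subseteq> torus n"
  obtains H :: "(nat \<Rightarrow> complex) \<Rightarrow> real"
  where "trig_poly n (2 * card \<Xi>) (\<lambda>z. of_real (H z))"
    "\<And>z. z \<in> torus n \<Longrightarrow> 0 \<le> H z \<and> H z \<le> 1"
    "\<And>z. z \<in> torus n \<Longrightarrow> H z = 1 \<longleftrightarrow> z \<in> \<Xi>"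
proof
  \<comment> \<open>On the torus the sum is at most 4 n; the added 1 keeps the denominator positive
    for n = 0.\<close>
  define S where "S = (\<lambda>\<xi> z. (1 / (4 * real n + 1)) * (\<Sum>k<n. (cmod (z k - \<xi> k))\<^sup>2))"
  define H where "H = (\<lambda>z. 1 - (\<Prod>\<xi>\<in>\<Xi>. S \<xi> z))"
  have S: "0 \<le> S \<xi> z \<and> S \<xi> z \<le> 1" "S \<xi> z = 0 \<longleftrightarrow> z = \<xi>"
    if "\<xi> \<in> \<Xi>" "z \<in> torus n" for \<xi> z
  proof -
    have t: "\<xi> \<in> torus n" using that assms by auto
    have "(cmod (z k - \<xi> k))\<^sup>2 \<le> 4" if "k < n" for k
    proof -
      have "cmod (z k - \<xi> k) \<le> cmod (z k) + cmod (\<xi> k)" by (rule norm_triangle_ineq4)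
      also have "\<dots> = 2" using t \<open>z \<in> torus n\<close> that by (auto simp: torus_def)
      finally have "(cmod (z k - \<xi> k))\<^sup>2 \<le> 2\<^sup>2" by (intro power_mono) auto
      then show ?thesis by simp
    qed
    then have "(\<Sum>k<n. (cmod (z k - \<xi> k))\<^sup>2) \<le> (\<Sum>k<n. 4)" by (intro sum_mono) auto
    then show "0 \<le> S \<xi> z \<and> S \<xi> z \<le> 1"
      by (auto simp: S_def field_simps sum_nonneg)
    have p: "1 / (4 * real n + 1) > 0" by simp
    have "S \<xi> z = 0 \<longleftrightarrow> (\<forall>k<n. z k = \<xi> k)"
      using p by (auto simp: S_def sum_nonneg_eq_0_iff add_nonneg_eq_0_iff)
    then show "S \<xi> z = 0 \<longleftrightarrow> z = \<xi>"
      using torus_eqI[OF \<open>z \<in> torus n\<close> t] by auto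
  qed
  have "trig_poly n (1 + 1) (\<lambda>z. of_real (S \<xi> z))" for \<xi>
  proof -
    have "trig_poly n (1 + 1) (\<lambda>z. of_real (1 / (4 * real n + 1)) *
        (\<Sum>k<n. (z k - \<xi> k) * cnj (z k - \<xi> k)))"
      by (intro trig_poly_scale trig_poly_sum trig_poly_mult trig_poly_cnj trig_poly_diff
          trig_poly_coordinate trig_poly_const) auto
    then show ?thesis by (simp add: S_def complex_norm_square flip: of_real_power)
  qed
  then show "trig_poly n (2 * card \<Xi>) (\<lambda>z. of_real (H z))"
    using trig_poly_diff[OF trig_poly_const[of n "2 * card \<Xi>" 1] trig_poly_prod[of \<Xi> n 2 "\<lambda>\<xi> z. of_real (S \<xi> z)"]]
    by (simp add: H_def numeral_2_eq_2)
  show "0 \<le> H z \<and> H z \<le> 1" if "z \<in> torus n" for z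
    using S that by (auto simp: H_def intro!: prod_nonneg prod_le_1)
  show "H z = 1 \<longleftrightarrow> z \<in> \<Xi>" if "z \<in> torus n" for z
    using S that assms by (auto simp: H_def)
qed

text \<open>Lagrange interpolation. For each other node \<open>\<eta>\<close> a coordinate
  \<open>\<kappa> \<xi> \<eta>\<close> is picked in which the two nodes differ; the normalised
  linear factor in that coordinate is 1 at \<open>\<xi>\<close> and 0 at \<open>\<eta>\<close>. The
  entropy is therefore an infimum over a nonempty set.\<close>

lemma interp_family_exists:
  assumes "finite \<Xi>" "\<Xi> \<subseteq> torus n"
  obtains u where "interp_family n \<Xi> u"
proof -
  have "\<exists>k<n. \<xi> k \<noteq> \<eta> k" if "\<xi> \<in> \<Xi>" "\<eta> \<in> \<Xi>" "\<xi> \<noteq> \<eta>" for \<xi> \<eta>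
    using torus_eqI that assms(2) by (meson subsetD)
  then obtain \<kappa> where \<kappa>: "\<kappa> \<xi> \<eta> < n \<and> \<xi> (\<kappa> \<xi> \<eta>) \<noteq> \<eta> (\<kappa> \<xi> \<eta>)"
    if "\<xi> \<in> \<Xi>" "\<eta> \<in> \<Xi>" "\<xi> \<noteq> \<eta>" for \<xi> \<eta>
    by metis
  define F where "F = (\<lambda>\<xi> z. \<Prod>\<eta>\<in>\<Xi> - {\<xi>}.
      (1 / (\<xi> (\<kappa> \<xi> \<eta>) - \<eta> (\<kappa> \<xi> \<eta>))) * (z (\<kappa> \<xi> \<eta>) - \<eta> (\<kappa> \<xi> \<eta>)))"
  have "\<exists>c. \<forall>z\<in>torus n. F \<xi> z = laurent_eval n (card \<Xi> - 1) c z" if "\<xi> \<in> \<Xi>" for \<xi>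
  proof -
    have "trig_poly n (1 * card (\<Xi> - {\<xi>})) (F \<xi>)"
      unfolding F_def using \<kappa> that
      by (intro trig_poly_prod trig_poly_scale trig_poly_diff trig_poly_coordinate trig_poly_const) auto
    then show ?thesis using that assms(1) by (auto simp: trig_poly_def)
  qed
  then obtain u where u: "F \<xi> z = laurent_eval n (card \<Xi> - 1) (u \<xi>) z"
    if "\<xi> \<in> \<Xi>" "z \<in> torus n" for \<xi> z
    by metis
  have "F \<xi> \<eta> = (if \<xi> = \<eta> then 1 else 0)" if "\<xi> \<in> \<Xi>" "\<eta> \<in> \<Xi>" for \<xi> \<eta>
  proof (cases "\<xi> = \<eta>")
    case True
    have "\<xi> (\<kappa> \<xi> x) \<noteq> x (\<kappa> \<xi> x)" if "x \<in> \<Xi> - {\<xi>}" for x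
      using \<kappa>[of \<xi> x] \<open>\<xi> \<in> \<Xi>\<close> that by auto
    then show ?thesis using True by (simp add: F_def)
  next
    case False
    then show ?thesis using assms that by (auto simp: F_def intro!: prod_zero)
  qed
  then have "interp_family n \<Xi> u"
    unfolding interp_family_def using u assms by (metis subsetD)
  then show ?thesis by (rule that)
qed

text \<open>The infimum defining the entropy need not be attained; the factor 2 pays for that.\<close>

lemma interp_family_entropy:
  assumes "finite \<Xi>" "\<Xi> \<subseteq> torus n" "\<Xi> \<noteq> {}"
  obtains u where "interp_family n \<Xi> u" "1 \<le> interp_entropy n \<Xi>"
    "\<And>\<xi> z. \<xi> \<in> \<Xi> \<Longrightarrow> z \<in> torus n \<Longrightarrow>
      (cmod (laurent_eval n (card \<Xi> - 1) (u \<xi>) z))\<^sup>2 \<le> 2 * interp_entropy n \<Xi>"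
proof -
  define V where "V = (\<lambda>u. SUP \<xi>\<in>\<Xi>. (SUP z\<in>torus n. (cmod (laurent_eval n (card \<Xi> - 1) (u \<xi>) z))\<^sup>2))"
  have V: "(cmod (laurent_eval n (card \<Xi> - 1) (u \<xi>) z))\<^sup>2 \<le> V u"
    if "\<xi> \<in> \<Xi>" "z \<in> torus n" for u \<xi> z
  proof -
    have "bdd_above ((\<lambda>z. (cmod (laurent_eval n (card \<Xi> - 1) (u \<xi>) z))\<^sup>2) ` torus n)"
      by (rule bdd_aboveI2[where M = "(\<Sum>\<alpha>\<in>A1 n (card \<Xi> - 1). cmod (u \<xi> \<alpha>))\<^sup>2"])
         (intro power_mono laurent_eval_bound norm_ge_zero)
    then have "(cmod (laurent_eval n (card \<Xi> - 1) (u \<xi>) z))\<^sup>2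
        \<le> (SUP z\<in>torus n. (cmod (laurent_eval n (card \<Xi> - 1) (u \<xi>) z))\<^sup>2)"
      by (rule cSUP_upper[OF that(2)])
    also have "\<dots> \<le> V u"
      unfolding V_def by (rule cSUP_upper[OF that(1)]) (simp add: assms(1))
    finally show ?thesis .
  qed
  let ?S = "{V u | u. interp_family n \<Xi> u}"
  have E: "interp_entropy n \<Xi> = Inf ?S" by (simp add: interp_entropy_def V_def)
  have ne: "?S \<noteq> {}" using interp_family_exists[OF assms(1,2)] by blast
  obtain \<xi> where \<xi>: "\<xi> \<in> \<Xi>" using assms(3) by blast
  \<comment> \<open>Each interpolation polynomial is 1 at its own node. The infimum is thus
    positive, so that doubling it exceeds it strictly and some family lies below the double.\<close>
  have "1 \<le> V u" if "interp_family n \<Xi> u" for u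
    using V[OF \<xi>, of \<xi> u] that \<xi> assms(2) by (auto simp: interp_family_def)
  then have 1: "1 \<le> Inf ?S" by (intro cInf_greatest[OF ne]) auto
  then have "Inf ?S < 2 * Inf ?S" by simp
  then obtain u where "interp_family n \<Xi> u" "V u < 2 * Inf ?S"
    using cInf_lessD[OF ne, of "2 * Inf ?S"] by blast
  then show ?thesis using that[of u] V[of _ _ u] 1 unfolding E by force
qed

text \<open>Write r for the number of nodes and \<delta> for the entropy. The Chebyshev factor has
  degree N (r - 1) with N \<le> 9 r sqrt(2 \<delta>) \<le> 18 r \<delta>, and the factor
  \<open>H\<close> has degree 2 r \<le> 2 r \<delta>; this accounts for the first two summands in
  the bound on \<open>d\<close>. The polynomials \<open>u\<close> are returned too, since uniqueness
  of the optimal measure needs them.\<close>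

lemma dual_certificate:
  fixes \<epsilon> :: "(nat \<Rightarrow> complex) \<Rightarrow> real"
  assumes \<Xi>: "finite \<Xi>" "\<Xi> \<subseteq> torus n"
    and \<epsilon>: "\<And>\<xi>. \<xi> \<in> \<Xi> \<Longrightarrow> \<epsilon> \<xi> \<in> {1, -1}"
    and d: "real d \<ge> (18 * (real (card \<Xi>))\<^sup>2 + 2 * real (card \<Xi>) + 1) * interp_entropy n \<Xi>"
  obtains f u where "dual_feasible n d f"
    "\<forall>\<xi>\<in>\<Xi>. Re (laurent_eval n d f \<xi>) = \<epsilon> \<xi>"
    "\<forall>z\<in>torus n - \<Xi>. \<bar>Re (laurent_eval n d f z)\<bar> < 1"
    "\<forall>\<xi>\<in>\<Xi>. \<forall>\<eta>\<in>\<Xi>. laurent_eval n d (u \<xi>) \<eta> = (if \<xi> = \<eta> then 1 else 0)"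
proof (cases "\<Xi> = {}")
  \<comment> \<open>The entropy estimates start from a node, so the empty set is treated apart, with
    the zero polynomial.\<close>
  case True
  then show ?thesis using that[of "\<lambda>_. 0"] by (auto simp: dual_feasible_def laurent_eval_def)
next
  case False
  define r where "r = card \<Xi>"
  define \<delta> where "\<delta> = interp_entropy n \<Xi>"
  have r: "r \<ge> 1" using False \<Xi> by (simp add: r_def Suc_leI card_gt_0_iff)
  obtain u where u: "interp_family n \<Xi> u" and \<delta>: "1 \<le> \<delta>"
    and ub: "\<And>\<xi> z. \<xi> \<in> \<Xi> \<Longrightarrow> z \<in> torus n \<Longrightarrow> (cmod (laurent_eval n (r - 1) (u \<xi>) z))\<^sup>2 \<le> 2 * \<delta>"
    using interp_family_entropy[OF \<Xi> False] unfolding r_def \<delta>_def by metis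
  define B where "B = real r * sqrt (2 * \<delta>)"
  \<comment> \<open>Since 2 \<delta> is at least 1, the square root can be replaced by 2 \<delta>,
    which makes the degree bound linear in \<delta>.\<close>
  have sq: "1 \<le> sqrt (2 * \<delta>)" "sqrt (2 * \<delta>) \<le> 2 * \<delta>"
    using \<delta> by (auto intro: real_le_lsqrt simp: power2_eq_square)
  have "1 * 1 \<le> real r * sqrt (2 * \<delta>)" using r sq by (intro mult_mono) auto
  then have "B \<ge> 1" by (simp add: B_def)
  then obtain N c where N: "real N \<le> 9 * B" and c: "0 \<le> c" "c * B \<le> 1"
    and peak: "chebyshev N c = (1::real)" "chebyshev N (- c) = (-1::real)"
    by (rule chebyshev_peak)
  obtain H :: "(nat \<Rightarrow> complex) \<Rightarrow> real" where H: "trig_poly n (2 * r) (\<lambda>z. of_real (H z))"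
    and H01: "\<And>z. z \<in> torus n \<Longrightarrow> 0 \<le> H z \<and> H z \<le> 1"
    and H1: "\<And>z. z \<in> torus n \<Longrightarrow> H z = 1 \<longleftrightarrow> z \<in> \<Xi>"
    using trig_poly_indicator[OF \<Xi>] unfolding r_def by metis
  \<comment> \<open>The scaling by \<open>c\<close> is built in:
    \<open>\<bar>w\<bar> \<le> c * B \<le> 1\<close> on the torus, and the nodes go to the peaks
    \<open>c\<close> and \<open>- c\<close>.\<close>
  define w where "w = (\<lambda>z. c * Re (\<Sum>\<xi>\<in>\<Xi>. of_real (\<epsilon> \<xi>) * laurent_eval n (r - 1) (u \<xi>) z))"
  have w_bound: "\<bar>w z\<bar> \<le> 1" if "z \<in> torus n" for z
  proof -
    have "cmod (\<Sum>\<xi>\<in>\<Xi>. of_real (\<epsilon> \<xi>) * laurent_eval n (r - 1) (u \<xi>) z) \<le> (\<Sum>\<xi>\<in>\<Xi>. sqrt (2 * \<delta>))"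
    proof (rule sum_norm_le)
      fix \<xi> assume \<xi>: "\<xi> \<in> \<Xi>"
      then have "\<bar>\<epsilon> \<xi>\<bar> = 1" using \<epsilon> by force
      then show "cmod (of_real (\<epsilon> \<xi>) * laurent_eval n (r - 1) (u \<xi>) z) \<le> sqrt (2 * \<delta>)"
        using ub[OF \<xi> that] by (simp add: norm_mult real_le_rsqrt)
    qed
    then have "\<bar>Re (\<Sum>\<xi>\<in>\<Xi>. of_real (\<epsilon> \<xi>) * laurent_eval n (r - 1) (u \<xi>) z)\<bar> \<le> B"
      by (intro order_trans[OF abs_Re_le_cmod]) (simp add: B_def r_def)
    then have "\<bar>w z\<bar> \<le> c * B" using c(1) by (simp add: w_def abs_mult mult_left_mono)
    then show ?thesis using c(2) by simp
  qed
  have w_node: "w \<xi> = c * \<epsilon> \<xi>" if "\<xi> \<in> \<Xi>" for \<xi>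
  proof -
    have "(\<Sum>\<eta>\<in>\<Xi>. of_real (\<epsilon> \<eta>) * laurent_eval n (r - 1) (u \<eta>) \<xi>)
        = (\<Sum>\<eta>\<in>\<Xi>. if \<eta> = \<xi> then of_real (\<epsilon> \<eta>) else 0)"
      using u that by (intro sum.cong) (auto simp: interp_family_def r_def)
    also have "\<dots> = of_real (\<epsilon> \<xi>)" using that \<Xi> by simp
    finally show ?thesis unfolding w_def by (simp only: Re_complex_of_real)
  qed
  \<comment> \<open>At a node the Chebyshev factor is the prescribed sign and \<open>H\<close> is 1;
    elsewhere \<open>\<bar>F z\<bar> \<le> H z < 1\<close>.\<close>
  define F where "F = (\<lambda>z. chebyshev N (w z) * H z)"
  have rd: "r - 1 \<le> d" and deg: "N * (r - 1) + 2 * r \<le> d"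
  proof -
    have "real N * real (r - 1) \<le> (9 * (real r * (2 * \<delta>))) * real r"
    proof (rule mult_mono)
      have "B \<le> real r * (2 * \<delta>)" unfolding B_def using sq by (intro mult_left_mono) auto
      then show "real N \<le> 9 * (real r * (2 * \<delta>))" using N by linarith
    qed (use \<delta> in auto)
    moreover have "2 * real r \<le> 2 * real r * \<delta>" using mult_left_mono[OF \<delta>, of "2 * real r"] by simp
    moreover have "(18 * (real r)\<^sup>2 + 2 * real r + 1) * \<delta>
        = (9 * (real r * (2 * \<delta>))) * real r + 2 * real r * \<delta> + \<delta>"
      by (simp add: algebra_simps power2_eq_square)
    ultimately have "real N * real (r - 1) + 2 * real r \<le> real d"
      using d \<delta> unfolding r_def[symmetric] \<delta>_def[symmetric] by linarith
    then have "real (N * (r - 1) + 2 * r) \<le> real d" by simp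
    then show "N * (r - 1) + 2 * r \<le> d" by (simp only: of_nat_le_iff)
    then show "r - 1 \<le> d" by simp
  qed
  have "trig_poly n (r - 1) (\<lambda>z. of_real (w z))"
  proof -
    have "trig_poly n (r - 1) (\<lambda>z. of_real c *
        of_real (Re (\<Sum>\<xi>\<in>\<Xi>. of_real (\<epsilon> \<xi>) * laurent_eval n (r - 1) (u \<xi>) z)))"
      by (intro trig_poly_scale trig_poly_Re trig_poly_sum trig_poly_laurent_eval)
    then show ?thesis by (simp add: w_def)
  qed
  then have "trig_poly n (N * (r - 1) + 2 * r) (\<lambda>z. chebyshev N (of_real (w z)) * of_real (H z))"
    by (intro trig_poly_mult trig_poly_chebyshev H)
  then have "trig_poly n d (\<lambda>z. of_real (F z))"
    using deg by (auto intro: trig_poly_mono simp: F_def chebyshev_of_real)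
  then obtain f where f: "\<And>z. z \<in> torus n \<Longrightarrow> laurent_eval n d f z = of_real (F z)"
    unfolding trig_poly_def by metis
  have F_bound: "\<bar>F z\<bar> \<le> H z" if "z \<in> torus n" for z
    using mult_right_mono[OF chebyshev_bound[OF w_bound[OF that], of N], of "H z"] H01[OF that]
    by (simp add: F_def abs_mult)
  \<comment> \<open>The interpolation polynomials are rewritten over \<open>A1 n d\<close>, the
    range of the prescribed moments.\<close>
  have "\<exists>v. \<forall>z\<in>torus n. laurent_eval n (r - 1) (u \<xi>) z = laurent_eval n d v z" for \<xi>
    using trig_poly_mono[OF trig_poly_laurent_eval rd] unfolding trig_poly_def by blast
  then obtain v where v: "\<And>\<xi> z. z \<in> torus n \<Longrightarrow> laurent_eval n (r - 1) (u \<xi>) z = laurent_eval n d (v \<xi>) z"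
    by metis
  show ?thesis
  proof
    show "dual_feasible n d f"
      using F_bound H01 by (force simp: dual_feasible_def f)
    have "Re (laurent_eval n d f \<xi>) = \<epsilon> \<xi>" if "\<xi> \<in> \<Xi>" for \<xi>
      using that \<Xi>(2) f[of \<xi>] w_node[OF that] \<epsilon>[OF that] peak H1[of \<xi>] by (auto simp: F_def)
    then show "\<forall>\<xi>\<in>\<Xi>. Re (laurent_eval n d f \<xi>) = \<epsilon> \<xi>" by blast
    have "\<bar>Re (laurent_eval n d f z)\<bar> < 1" if "z \<in> torus n" "z \<notin> \<Xi>" for z
      using F_bound[of z] H01[of z] H1[of z] that f[of z] by force
    then show "\<forall>z\<in>torus n - \<Xi>. \<bar>Re (laurent_eval n d f z)\<bar> < 1" by blast
    have "laurent_eval n d (v \<xi>) \<eta> = (if \<xi> = \<eta> then 1 else 0)" if "\<xi> \<in> \<Xi>" "\<eta> \<in> \<Xi>" for \<xi> \<eta>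
      using u v[of \<eta> \<xi>] that \<Xi>(2) by (auto simp: interp_family_def r_def)
    then show "\<forall>\<xi>\<in>\<Xi>. \<forall>\<eta>\<in>\<Xi>. laurent_eval n d (v \<xi>) \<eta> = (if \<xi> = \<eta> then 1 else 0)"
      by blast
  qed
qed

section \<open>Signed measures\<close>

lemma signed_measure_Un:
  assumes "signed_measure M \<nu>" "A \<in> sets M" "B \<in> sets M" "A \<inter> B = {}"
  shows "\<nu> (A \<union> B) = \<nu> A + \<nu> B"
proof -
  have "disjoint_family (binaryset A B)"
    using assms(4) by (auto simp: disjoint_family_on_def binaryset_def)
  moreover have "range (binaryset A B) \<subseteq> sets M"
    using assms by (auto simp: binaryset_def)
  ultimately have "(\<lambda>i. \<nu> (binaryset A B i)) sums \<nu> (\<Union>i. binaryset A B i)"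
    using assms(1) unfolding signed_measure_def by blast
  then have "(\<lambda>i. \<nu> (binaryset A B i)) sums \<nu> (A \<union> B)"
    by (simp only: UN_binaryset_eq)
  moreover have "(\<lambda>i. \<nu> (binaryset A B i)) sums (\<nu> A + \<nu> B)"
    using assms(1) by (intro binaryset_sums) (simp add: signed_measure_def)
  ultimately show ?thesis by (rule sums_unique2)
qed

lemma signed_measure_split:
  assumes "signed_measure M \<nu>" "A \<in> sets M" "B \<in> sets M"
  shows "\<nu> A = \<nu> (A \<inter> B) + \<nu> (A - B)"
proof -
  have "\<nu> ((A \<inter> B) \<union> (A - B)) = \<nu> (A \<inter> B) + \<nu> (A - B)"
    using assms by (intro signed_measure_Un) auto
  then show ?thesis by (simp only: Int_Diff_Un)
qed

lemma signed_measure_uminus: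
  assumes "signed_measure M \<nu>"
  shows "signed_measure M (\<lambda>A. - \<nu> A)"
  unfolding signed_measure_def
proof (intro conjI allI impI)
  fix A :: "nat \<Rightarrow> _" assume "range A \<subseteq> sets M" "disjoint_family A"
  then have "(\<lambda>i. \<nu> (A i)) sums \<nu> (\<Union>i. A i)"
    using assms unfolding signed_measure_def by blast
  then show "(\<lambda>i. - \<nu> (A i)) sums - \<nu> (\<Union>i. A i)" by (rule sums_minus)
qed (use assms in \<open>simp_all add: signed_measure_def\<close>)

text \<open>If \<open>\<nu>\<close> were unbounded above, every measurable set carrying unboundedly large values would split
  into a part of absolute measure at least 1 and a remainder with the same property; the parts peeled
  off are disjoint, contradicting the convergence of their measures.\<close>

lemma signed_measure_bdd:
  assumes sm: "signed_measure M \<nu>"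
  shows "bdd_above (\<nu> ` sets M)"
proof -
  define U where "U = (\<lambda>E. E \<in> sets M \<and> (\<forall>c. \<exists>B\<in>sets M. B \<subseteq> E \<and> \<nu> B > c))"
  have step: "\<exists>A. U A \<and> A \<subseteq> E \<and> 1 \<le> \<bar>\<nu> (E - A)\<bar>" if "U E" for E
  proof -
    \<comment> \<open>With this margin both \<open>\<nu> A\<close> and \<open>\<nu> (E - A)\<close>
      exceed 1 in absolute value, so either part may be peeled off, whichever of the two is
      kept.\<close>
    obtain A where A: "A \<in> sets M" "A \<subseteq> E" "\<nu> A > \<bar>\<nu> E\<bar> + 1"
      using \<open>U E\<close> unfolding U_def by blast
    have E: "E \<in> sets M" using \<open>U E\<close> by (simp add: U_def)
    have s: "\<nu> E = \<nu> A + \<nu> (E - A)"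
      using signed_measure_split[OF sm E A(1)] A(2) by (simp add: Int_absorb1)
    show ?thesis
    proof (cases "U A")
      case True
      moreover have "1 \<le> \<bar>\<nu> (E - A)\<bar>" using A(3) s by linarith
      ultimately show ?thesis using A(2) by blast
    next
      case False
      then obtain c where c: "\<And>B. B \<in> sets M \<Longrightarrow> B \<subseteq> A \<Longrightarrow> \<nu> B \<le> c"
        using A(1) unfolding U_def by (meson not_less)
      have "\<exists>B\<in>sets M. B \<subseteq> E - A \<and> \<nu> B > b" for b
      proof -
        \<comment> \<open>As \<open>\<nu>\<close> is at most \<open>c\<close> on subsets of
          \<open>A\<close>, a value above b + c on \<open>B\<close> leaves more than b outside
          \<open>A\<close>.\<close>
        obtain B where B: "B \<in> sets M" "B \<subseteq> E" "\<nu> B > b + c"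
          using \<open>U E\<close> unfolding U_def by blast
        have "\<nu> (B \<inter> A) \<le> c" using c[of "B \<inter> A"] B A by auto
        then have "\<nu> (B - A) > b" using signed_measure_split[OF sm B(1) A(1)] B(3) by linarith
        then show ?thesis using B A by (intro bexI[of _ "B - A"]) auto
      qed
      then have "U (E - A)" using E A by (auto simp: U_def)
      moreover have "E - (E - A) = A" using A by auto
      moreover have "1 \<le> \<bar>\<nu> A\<bar>" using A(3) by linarith
      ultimately show ?thesis by (metis Diff_subset)
    qed
  qed
  have "\<not> U (space M)"
  proof
    assume U0: "U (space M)"
    obtain nx where nx: "\<And>E. U E \<Longrightarrow> U (nx E) \<and> nx E \<subseteq> E \<and> 1 \<le> \<bar>\<nu> (E - nx E)\<bar>"
      using step by metis
    define E where "E = (\<lambda>k. (nx ^^ k) (space M))"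
    have ES: "E (Suc k) = nx (E k)" for k by (simp add: E_def)
    have UE: "U (E k)" for k
    proof (induction k)
      case (Suc k)
      then show ?case unfolding ES by (rule nx[THEN conjunct1])
    qed (simp add: E_def U0)
    have dec: "decseq E"
      unfolding decseq_Suc_iff ES using nx[OF UE] by blast
    define D where "D = (\<lambda>k. E k - E (Suc k))"
    have "D i \<inter> D j = {}" if "i < j" for i j
    proof -
      have "E j \<subseteq> E (Suc i)" using that by (intro decseqD[OF dec]) simp
      then show ?thesis unfolding D_def by blast
    qed
    then have "disjoint_family D"
      unfolding disjoint_family_on_def using linorder_neqE_nat by (metis Int_commute)
    moreover have "E k \<in> sets M" for k using UE[of k] by (simp add: U_def)
    then have "range D \<subseteq> sets M" by (auto simp: D_def)
    ultimately have "(\<lambda>k. \<nu> (D k)) sums \<nu> (\<Union>k. D k)"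
      using sm by (simp add: signed_measure_def)
    then have "(\<lambda>k. \<nu> (D k)) \<longlonglongrightarrow> 0"
      by (intro summable_LIMSEQ_zero) (simp add: sums_iff)
    then have "eventually (\<lambda>k. \<bar>\<nu> (D k)\<bar> < 1) sequentially"
      using tendstoD[of "\<lambda>k. \<nu> (D k)" 0 sequentially 1] by (simp add: dist_real_def)
    then obtain k where "\<bar>\<nu> (D k)\<bar> < 1" by (auto simp: eventually_sequentially)
    moreover have "1 \<le> \<bar>\<nu> (D k)\<bar>" using nx[OF UE] by (simp add: D_def ES)
    ultimately show False by simp
  qed
  then obtain K where "\<And>B. B \<in> sets M \<Longrightarrow> B \<subseteq> space M \<Longrightarrow> \<nu> B \<le> K"
    unfolding U_def by (meson not_less sets.top)
  then show ?thesis using sets.sets_into_space by (intro bdd_aboveI2[of _ _ K]) blast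
qed

section \<open>Positive and negative variations, Jordan decomposition and total variation\<close>

definition upper_var :: "'a measure \<Rightarrow> ('a set \<Rightarrow> real) \<Rightarrow> 'a set \<Rightarrow> real" where
  "upper_var M \<nu> A = (SUP B\<in>{B\<in>sets M. B \<subseteq> A}. \<nu> B)"

text \<open>This is where \<open>signed_measure_bdd\<close> enters: a supremum of reals bounds its
  elements only when the set is bounded above.\<close>

lemma upper_var_ge:
  assumes "signed_measure M \<nu>" "B \<in> sets M" "B \<subseteq> A"
  shows "\<nu> B \<le> upper_var M \<nu> A"
proof -
  have "bdd_above (\<nu> ` {B\<in>sets M. B \<subseteq> A})"
    by (rule bdd_above_mono[OF signed_measure_bdd[OF assms(1)]]) auto
  then show ?thesis unfolding upper_var_def using assms by (intro cSUP_upper) auto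
qed

lemma upper_var_le:
  assumes "\<And>B. B \<in> sets M \<Longrightarrow> B \<subseteq> A \<Longrightarrow> \<nu> B \<le> c"
  shows "upper_var M \<nu> A \<le> c"
  unfolding upper_var_def using assms by (intro cSUP_least) auto

lemma upper_var_approx:
  assumes "c < upper_var M \<nu> A"
  obtains B where "B \<in> sets M" "B \<subseteq> A" "c < \<nu> B"
  using assms upper_var_le[of M A \<nu> c] by (meson not_le)

lemma upper_var_nonneg: "signed_measure M \<nu> \<Longrightarrow> 0 \<le> upper_var M \<nu> A"
  using upper_var_ge[of M \<nu> "{}" A] by (simp add: signed_measure_def)

text \<open>\<open>\<nu> B + \<nu> B'\<close> is the value on the disjoint union. The supremum is
  taken over \<open>B\<close> with \<open>B'\<close> fixed, and then over \<open>B'\<close>.\<close>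

lemma upper_var_superadditive:
  assumes sm: "signed_measure M \<nu>" and "A \<inter> A' = {}"
  shows "upper_var M \<nu> A + upper_var M \<nu> A' \<le> upper_var M \<nu> (A \<union> A')"
proof -
  have "upper_var M \<nu> A \<le> upper_var M \<nu> (A \<union> A') - \<nu> B'" if "B' \<in> sets M" "B' \<subseteq> A'" for B'
  proof (rule upper_var_le)
    fix B assume B: "B \<in> sets M" "B \<subseteq> A"
    have "\<nu> B + \<nu> B' = \<nu> (B \<union> B')"
      using B that assms by (intro signed_measure_Un[symmetric, OF sm]) auto
    also have "\<dots> \<le> upper_var M \<nu> (A \<union> A')"
      using B that by (intro upper_var_ge[OF sm]) auto
    finally show "\<nu> B \<le> upper_var M \<nu> (A \<union> A') - \<nu> B'" by simp
  qed
  then have "upper_var M \<nu> A' \<le> upper_var M \<nu> (A \<union> A') - upper_var M \<nu> A"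
    by (intro upper_var_le) force
  then show ?thesis by simp
qed

text \<open>Two inequalities. Superadditivity and monotonicity bound the partial sums by the value
  on the union, which also gives summability. Conversely, a measurable \<open>B\<close> inside the
  union is cut into the pieces \<open>B \<inter> A i\<close>, each of value at most the upper
  variation of \<open>A i\<close>.\<close>

lemma upper_var_sums:
  assumes sm: "signed_measure M \<nu>" and A: "range A \<subseteq> sets M" "disjoint_family (A :: nat \<Rightarrow> _)"
  shows "(\<lambda>i. upper_var M \<nu> (A i)) sums upper_var M \<nu> (\<Union>i. A i)"
proof -
  let ?P = "upper_var M \<nu>"
  have mono: "?P B \<le> ?P C" if "B \<subseteq> C" for B C
    using that by (intro upper_var_le upper_var_ge[OF sm]) auto
  have fin: "(\<Sum>i<k. ?P (A i)) \<le> ?P (\<Union>i<k. A i)" for k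
  proof (induction k)
    case (Suc k)
    have "A i \<inter> A k = {}" if "i < k" for i
      using disjoint_family_onD[OF A(2), of i k] that by simp
    then have "(\<Union>i<k. A i) \<inter> A k = {}" by blast
    from upper_var_superadditive[OF sm this] Suc show ?case
      by (simp add: lessThan_Suc Un_commute add.commute)
  qed (simp add: upper_var_nonneg[OF sm])
  have part: "(\<Sum>i<k. ?P (A i)) \<le> ?P (\<Union>i. A i)" for k
    using fin[of k] mono[of "\<Union>i<k. A i" "\<Union>i. A i"] by fastforce
  have summ: "summable (\<lambda>i. ?P (A i))"
    by (rule summableI_nonneg_bounded[OF upper_var_nonneg[OF sm] part])
  have "?P (\<Union>i. A i) \<le> (\<Sum>i. ?P (A i))"
  proof (rule upper_var_le)
    fix B assume B: "B \<in> sets M" "B \<subseteq> (\<Union>i. A i)"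
    have "disjoint_family (\<lambda>i. B \<inter> A i)" "range (\<lambda>i. B \<inter> A i) \<subseteq> sets M"
      using A B by (auto simp: disjoint_family_on_def)
    then have "(\<lambda>i. \<nu> (B \<inter> A i)) sums \<nu> (\<Union>i. B \<inter> A i)"
      using sm unfolding signed_measure_def by blast
    moreover have "(\<Union>i. B \<inter> A i) = B" using B by auto
    ultimately have s: "(\<lambda>i. \<nu> (B \<inter> A i)) sums \<nu> B" by simp
    have "\<nu> (B \<inter> A i) \<le> ?P (A i)" for i
      using A B by (intro upper_var_ge[OF sm]) auto
    then show "\<nu> B \<le> (\<Sum>i. ?P (A i))"
      using sums_le[OF _ s summable_sums[OF summ]] by blast
  qed
  moreover have "(\<Sum>i. ?P (A i)) \<le> ?P (\<Union>i. A i)"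
    by (rule suminf_le_const[OF summ part])
  ultimately have "(\<Sum>i. ?P (A i)) = ?P (\<Union>i. A i)" by (rule antisym[rotated])
  then show ?thesis using summable_sums[OF summ] by simp
qed

lemma space_pos_variation [simp]: "space (pos_variation M \<nu>) = space M"
  unfolding pos_variation_def by (rule space_measure_of[OF sets.space_closed])

lemma sets_pos_variation [simp, measurable_cong]: "sets (pos_variation M \<nu>) = sets M"
  unfolding pos_variation_def by (rule sets.sets_measure_of_eq)

lemma space_neg_variation [simp]: "space (neg_variation M \<nu>) = space M"
  unfolding neg_variation_def by (rule space_pos_variation)

lemma sets_neg_variation [simp, measurable_cong]: "sets (neg_variation M \<nu>) = sets M"
  unfolding neg_variation_def by (rule sets_pos_variation)

text \<open>\<open>measure_of\<close> reproduces the given set function once positivity and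
  countable additivity are established, which the preceding lemmas provide.\<close>

lemma emeasure_pos_variation:
  assumes sm: "signed_measure M \<nu>" and "A \<in> sets M"
  shows "emeasure (pos_variation M \<nu>) A = ennreal (upper_var M \<nu> A)"
proof (rule emeasure_measure_of)
  show "pos_variation M \<nu> = measure_of (space M) (sets M) (\<lambda>A. ennreal (upper_var M \<nu> A))"
    unfolding pos_variation_def upper_var_def ..
  show "sets M \<subseteq> Pow (space M)" by (rule sets.space_closed)
  have "upper_var M \<nu> {} = 0"
    using upper_var_le[of M "{}" \<nu> 0] upper_var_nonneg[OF sm, of "{}"] sm
    by (simp add: signed_measure_def)
  then show "positive (sets (pos_variation M \<nu>)) (\<lambda>A. ennreal (upper_var M \<nu> A))"
    by (simp add: positive_def)
  show "countably_additive (sets (pos_variation M \<nu>)) (\<lambda>A. ennreal (upper_var M \<nu> A))"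
    unfolding countably_additive_def sets_pos_variation
    by (intro allI impI suminf_ennreal_eq upper_var_nonneg[OF sm] upper_var_sums[OF sm])
qed (use assms in simp)

lemma measure_pos_variation:
  "signed_measure M \<nu> \<Longrightarrow> A \<in> sets M \<Longrightarrow> measure (pos_variation M \<nu>) A = upper_var M \<nu> A"
  by (simp add: measure_def emeasure_pos_variation upper_var_nonneg)

lemma measure_neg_variation:
  "signed_measure M \<nu> \<Longrightarrow> A \<in> sets M \<Longrightarrow> measure (neg_variation M \<nu>) A = upper_var M (\<lambda>A. - \<nu> A) A"
  unfolding neg_variation_def by (intro measure_pos_variation signed_measure_uminus)

lemma finite_measure_pos_variation: "signed_measure M \<nu> \<Longrightarrow> finite_measure (pos_variation M \<nu>)"
  by (intro finite_measureI) (simp add: emeasure_pos_variation)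

lemma finite_measure_neg_variation: "signed_measure M \<nu> \<Longrightarrow> finite_measure (neg_variation M \<nu>)"
  unfolding neg_variation_def by (intro finite_measure_pos_variation signed_measure_uminus)

text \<open>No Hahn decomposition is needed: for \<open>B \<subseteq> A\<close> one has \<open>\<nu> B - \<nu> A = - \<nu> (A - B)\<close>, and taking suprema over
  \<open>B\<close> turns this into the claim.\<close>

lemma jordan_decomposition:
  assumes "signed_measure M \<nu>" "A \<in> sets M"
  shows "\<nu> A = measure (pos_variation M \<nu>) A - measure (neg_variation M \<nu>) A"
proof -
  have le: "upper_var M \<mu> A \<le> \<mu> A + upper_var M (\<lambda>A. - \<mu> A) A" if sm: "signed_measure M \<mu>" for \<mu>
  proof (rule upper_var_le)
    fix B assume B: "B \<in> sets M" "B \<subseteq> A"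
    have "\<mu> A = \<mu> B + \<mu> (A - B)"
      using signed_measure_split[OF sm assms(2) B(1)] B(2) by (simp add: Int_absorb1)
    moreover have "- \<mu> (A - B) \<le> upper_var M (\<lambda>A. - \<mu> A) A"
      using assms(2) B by (intro upper_var_ge[OF signed_measure_uminus[OF sm]]) auto
    ultimately show "\<mu> B \<le> \<mu> A + upper_var M (\<lambda>A. - \<mu> A) A" by simp
  qed
  show ?thesis
    using le[OF assms(1)] le[OF signed_measure_uminus[OF assms(1)]] assms
    by (simp add: measure_pos_variation measure_neg_variation)
qed

text \<open>The upper bound sums \<open>\<bar>\<nu> A\<bar> \<le> ?p A + ?n A\<close> over a
  disjoint family. For the lower bound an approximate Hahn set suffices: the two-member family of a
  nearly maximising \<open>B\<close> and its complement.\<close>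

lemma tv_norm_eq:
  assumes sm: "signed_measure M \<nu>"
  shows "tv_norm M \<nu> = measure (pos_variation M \<nu>) (space M) + measure (neg_variation M \<nu>) (space M)"
    (is "_ = ?P + ?N")
proof -
  interpret P: finite_measure "pos_variation M \<nu>" by (rule finite_measure_pos_variation[OF sm])
  interpret N: finite_measure "neg_variation M \<nu>" by (rule finite_measure_neg_variation[OF sm])
  let ?p = "measure (pos_variation M \<nu>)" and ?n = "measure (neg_variation M \<nu>)"
  let ?F = "{P. finite P \<and> P \<subseteq> sets M \<and> disjoint P}"
  have upper: "(\<Sum>A\<in>Q. \<bar>\<nu> A\<bar>) \<le> ?P + ?N" if Q: "Q \<in> ?F" for Q
  proof -
    have d: "disjoint_family_on (\<lambda>A. A) Q"
      using Q by (auto simp: disjoint_family_on_def disjoint_def)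
    have "(\<Sum>A\<in>Q. \<bar>\<nu> A\<bar>) \<le> (\<Sum>A\<in>Q. ?p A + ?n A)"
    proof (rule sum_mono)
      fix A assume "A \<in> Q"
      then have "\<nu> A = ?p A - ?n A"
        using Q by (intro jordan_decomposition[OF sm]) auto
      moreover have "0 \<le> ?p A" "0 \<le> ?n A" by auto
      ultimately show "\<bar>\<nu> A\<bar> \<le> ?p A + ?n A" by linarith
    qed
    also have "\<dots> = ?p (\<Union>A\<in>Q. A) + ?n (\<Union>A\<in>Q. A)"
      using Q d by (subst (1 2) measure_finite_Union)
        (auto simp: sum.distrib P.emeasure_eq_measure N.emeasure_eq_measure)
    also have "\<dots> \<le> ?P + ?N"
      using P.bounded_measure N.bounded_measure by (intro add_mono) (simp_all add: add_mono)
    finally show ?thesis .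
  qed
  have "?P + ?N \<le> tv_norm M \<nu> + e" if "e > 0" for e
  proof -
    \<comment> \<open>Half of \<open>e\<close>, because \<open>\<nu> B\<close> counts twice: \<nu> B
      - \<nu> (space M - B) = 2 \<nu> B - \<nu> (space M), and \<nu> (space M) = ?P - ?N.\<close>
    have "?P - e / 2 < upper_var M \<nu> (space M)"
      using that by (simp add: measure_pos_variation[OF sm])
    then obtain B where B: "B \<in> sets M" "?P - e / 2 < \<nu> B" by (rule upper_var_approx)
    have s: "\<nu> (space M) = \<nu> B + \<nu> (space M - B)"
      using signed_measure_split[OF sm sets.top B(1)] B(1) by (simp add: Int_absorb1 sets.sets_into_space)
    have J: "\<nu> (space M) = ?P - ?N" by (rule jordan_decomposition[OF sm sets.top])
    show ?thesis
    proof (cases "B = space M - B")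
      \<comment> \<open>Here the two-member family would collapse to a single set; this happens only
        for an empty space, where both variations vanish.\<close>
      case True
      then have "space M = {}" using sets.sets_into_space[OF B(1)] by auto
      moreover have "tv_norm M \<nu> \<ge> 0"
        unfolding tv_norm_def by (rule cSUP_upper2[of _ _ "{}"]) (auto intro: bdd_aboveI2 upper)
      ultimately show ?thesis using that by simp
    next
      case False
      have "(\<Sum>A\<in>{B, space M - B}. \<bar>\<nu> A\<bar>) \<le> tv_norm M \<nu>"
        unfolding tv_norm_def using B
        by (intro cSUP_upper bdd_aboveI2[of _ _ "?P + ?N"] upper) (auto simp: disjoint_def)
      then have "\<bar>\<nu> B\<bar> + \<bar>\<nu> (space M - B)\<bar> \<le> tv_norm M \<nu>" using False by simp
      then show ?thesis using s J B(2) by linarith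
    qed
  qed
  then have "?P + ?N \<le> tv_norm M \<nu>" by (rule field_le_epsilon)
  moreover have "tv_norm M \<nu> \<le> ?P + ?N"
    unfolding tv_norm_def by (rule cSUP_least) (use upper in \<open>auto intro: exI[of _ "{}"]\<close>)
  ultimately show ?thesis by simp
qed

section \<open>Measures carried by finitely many atoms\<close>

lemma finite_in_sets:
  assumes "finite \<Xi>" "\<And>\<xi>. \<xi> \<in> \<Xi> \<Longrightarrow> {\<xi>} \<in> sets M"
  shows "\<Xi> \<in> sets M"
proof -
  have "(\<Union>\<xi>\<in>\<Xi>. {\<xi>}) \<in> sets M" using assms by (rule sets.finite_UN)
  then show ?thesis by simp
qed

lemma null_off_atoms:
  assumes "finite_measure P" "finite \<Xi>" "\<And>\<xi>. \<xi> \<in> \<Xi> \<Longrightarrow> {\<xi>} \<in> sets P"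
    and "measure P (space P - \<Xi>) = 0"
  shows "AE x in P. x \<in> \<Xi>"
proof -
  interpret finite_measure P by fact
  have "\<Xi> \<in> sets P" using assms(2,3) by (rule finite_in_sets)
  then show ?thesis
    using assms(4) by (intro AE_I[of _ _ "space P - \<Xi>"]) (auto simp: emeasure_eq_measure)
qed

lemma integral_atoms:
  fixes f :: "'a \<Rightarrow> complex"
  assumes fm: "finite_measure P" and \<Xi>: "finite \<Xi>" "\<And>\<xi>. \<xi> \<in> \<Xi> \<Longrightarrow> {\<xi>} \<in> sets P"
    and ae: "AE x in P. x \<in> \<Xi>" and f: "f \<in> borel_measurable P"
  shows "integral\<^sup>L P f = (\<Sum>\<xi>\<in>\<Xi>. f \<xi> * of_real (measure P {\<xi>}))"
proof -
  interpret finite_measure P by fact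
  have "integral\<^sup>L P f = (\<integral>x. (\<Sum>\<xi>\<in>\<Xi>. indicator {\<xi>} x *\<^sub>R f \<xi>) \<partial>P)"
  proof (rule integral_cong_AE[OF f])
    show "(\<lambda>x. \<Sum>\<xi>\<in>\<Xi>. indicator {\<xi>} x *\<^sub>R f \<xi>) \<in> borel_measurable P"
      using \<Xi> by (intro borel_measurable_sum borel_measurable_scaleR borel_measurable_indicator) auto
    show "AE x in P. f x = (\<Sum>\<xi>\<in>\<Xi>. indicator {\<xi>} x *\<^sub>R f \<xi>)"
      using ae
    proof eventually_elim
      case (elim x)
      have "(\<Sum>\<xi>\<in>\<Xi>. indicator {\<xi>} x *\<^sub>R f \<xi>) = (\<Sum>\<xi>\<in>\<Xi>. if \<xi> = x then f \<xi> else 0)"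
        by (intro sum.cong) auto
      then show ?case using elim \<Xi> by simp
    qed
  qed
  also have "\<dots> = (\<Sum>\<xi>\<in>\<Xi>. \<integral>x. indicator {\<xi>} x *\<^sub>R f \<xi> \<partial>P)"
    using \<Xi> by (intro Bochner_Integration.integral_sum integrable_scaleR_left)
      (auto simp: emeasure_eq_measure intro!: integrable_real_indicator)
  also have "\<dots> = (\<Sum>\<xi>\<in>\<Xi>. f \<xi> * of_real (measure P {\<xi>}))"
    using \<Xi> by (intro sum.cong)
      (auto simp: scaleR_conv_of_real mult.commute emeasure_eq_measure sets.Int_space_eq2)
  finally show ?thesis .
qed

lemma signed_integral_atoms:
  fixes f :: "'a \<Rightarrow> complex"
  assumes sm: "signed_measure M \<nu>" and \<Xi>: "finite \<Xi>" "\<And>\<xi>. \<xi> \<in> \<Xi> \<Longrightarrow> {\<xi>} \<in> sets M"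
    and P: "AE x in pos_variation M \<nu>. x \<in> \<Xi>" and N: "AE x in neg_variation M \<nu>. x \<in> \<Xi>"
    and f: "f \<in> borel_measurable M"
  shows "signed_integral M \<nu> f = (\<Sum>\<xi>\<in>\<Xi>. f \<xi> * of_real (\<nu> {\<xi>}))"
proof -
  have "signed_integral M \<nu> f = (\<Sum>\<xi>\<in>\<Xi>. f \<xi> * of_real (measure (pos_variation M \<nu>) {\<xi>}))
      - (\<Sum>\<xi>\<in>\<Xi>. f \<xi> * of_real (measure (neg_variation M \<nu>) {\<xi>}))"
    unfolding signed_integral_def
    using integral_atoms[OF finite_measure_pos_variation[OF sm] \<Xi>(1) _ P, of f]
      integral_atoms[OF finite_measure_neg_variation[OF sm] \<Xi>(1) _ N, of f] \<Xi>(2) f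
    by (simp cong: measurable_cong_sets)
  also have "\<dots> = (\<Sum>\<xi>\<in>\<Xi>. f \<xi> * of_real (\<nu> {\<xi>}))"
    using \<Xi>(2) by (simp add: jordan_decomposition[OF sm] algebra_simps flip: sum_subtractf)
  finally show ?thesis .
qed

section \<open>Duality on the torus\<close>

lemma space_torus_space [simp]: "space (torus_space n) = torus n"
  by (simp add: torus_space_def space_restrict_space)

lemma singleton_sets_torus_space:
  assumes "\<xi> \<in> torus n"
  shows "{\<xi>} \<in> sets (torus_space n)"
proof -
  have "{\<xi>} = torus n \<inter> {\<xi>}" using assms by auto
  moreover have "{\<xi>} \<in> sets borel" by (rule borel_singleton[OF sets.empty_sets])
  ultimately show ?thesis unfolding torus_space_def sets_restrict_space by (rule image_eqI)
qed

lemma measurable_monom: "(\<lambda>z. monom n z \<alpha>) \<in> borel_measurable (torus_space n)"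
proof -
  have c: "(\<lambda>z :: nat \<Rightarrow> complex. z i) \<in> borel_measurable borel" for i
    by (intro borel_measurable_continuous_onI continuous_on_product_coordinates)
  have "(\<lambda>z :: nat \<Rightarrow> complex. z i powi k) \<in> borel_measurable borel" for i k
  proof (cases "0 \<le> k")
    case True
    then have "(\<lambda>z :: nat \<Rightarrow> complex. z i powi k) = (\<lambda>z. z i ^ nat k)"
      by (simp add: power_int_def)
    then show ?thesis using borel_measurable_power[OF c] by simp
  next
    case False
    then have "(\<lambda>z :: nat \<Rightarrow> complex. z i powi k) = (\<lambda>z. inverse (z i) ^ nat (- k))"
      by (simp add: power_int_def)
    then show ?thesis using borel_measurable_power[OF borel_measurable_inverse[OF c]] by simp
  qed
  then show ?thesis
    unfolding torus_space_def monom_def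
    by (intro measurable_restrict_space1 borel_measurable_prod)
qed

lemma measurable_laurent_eval: "laurent_eval n d f \<in> borel_measurable (torus_space n)"
  unfolding laurent_eval_def[abs_def]
  by (intro borel_measurable_sum borel_measurable_times borel_measurable_const measurable_monom)

lemma integrable_laurent_eval:
  assumes "finite_measure P" and s: "sets P = sets (torus_space n)"
  shows "integrable P (laurent_eval n d f)" "integrable P (\<lambda>z. monom n z \<alpha>)"
proof -
  interpret finite_measure P by fact
  have sp: "space P = torus n" using sets_eq_imp_space_eq[OF s] by simp
  show "integrable P (laurent_eval n d f)"
  proof (rule integrable_const_bound)
    show "AE x in P. cmod (laurent_eval n d f x) \<le> (\<Sum>\<alpha>\<in>A1 n d. cmod (f \<alpha>))"
      by (intro AE_I2 laurent_eval_bound) (simp add: sp)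
    show "laurent_eval n d f \<in> borel_measurable P"
      using measurable_laurent_eval measurable_cong_sets[OF s refl] by blast
  qed
  show "integrable P (\<lambda>z. monom n z \<alpha>)"
  proof (rule integrable_const_bound)
    show "AE x in P. cmod (monom n x \<alpha>) \<le> 1"
      by (intro AE_I2) (simp add: sp norm_monom)
    show "(\<lambda>z. monom n z \<alpha>) \<in> borel_measurable P"
      using measurable_monom measurable_cong_sets[OF s refl] by blast
  qed
qed

lemma signed_integral_laurent_eval:
  assumes sm: "signed_measure (torus_space n) \<nu>"
  shows "signed_integral (torus_space n) \<nu> (laurent_eval n d f)
    = (\<Sum>\<alpha>\<in>A1 n d. f \<alpha> * signed_integral (torus_space n) \<nu> (\<lambda>z. monom n z \<alpha>))"
proof -
  have "integral\<^sup>L P (laurent_eval n d f) = (\<Sum>\<alpha>\<in>A1 n d. f \<alpha> * integral\<^sup>L P (\<lambda>z. monom n z \<alpha>))"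
    if "finite_measure P" "sets P = sets (torus_space n)" for P
    unfolding laurent_eval_def[abs_def] using integrable_laurent_eval(2)[OF that]
    by (subst Bochner_Integration.integral_sum) auto
  from this[OF finite_measure_pos_variation[OF sm] sets_pos_variation]
    this[OF finite_measure_neg_variation[OF sm] sets_neg_variation]
  show ?thesis
    by (simp add: signed_integral_def right_diff_distrib sum_subtractf)
qed

lemma primal_feasible_integral:
  assumes "primal_feasible n d \<sigma> \<mu>"
  shows "signed_integral (torus_space n) \<mu> (laurent_eval n d f) = (\<Sum>\<alpha>\<in>A1 n d. \<sigma> \<alpha> * f \<alpha>)"
  using assms by (simp add: primal_feasible_def signed_integral_laurent_eval mult.commute)

text \<open>The gap is kept as an exact identity because for dual feasible \<open>f\<close> both
  integrands are nonnegative: weak duality is nonnegativity of the right-hand side, and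
  complementary slackness is the case where it vanishes.\<close>

lemma duality_gap:
  assumes pf: "primal_feasible n d \<sigma> \<mu>"
  shows "tv_norm (torus_space n) \<mu> - dual_objective n d \<sigma> f
    = (\<integral>z. 1 - Re (laurent_eval n d f z) \<partial>pos_variation (torus_space n) \<mu>)
    + (\<integral>z. 1 + Re (laurent_eval n d f z) \<partial>neg_variation (torus_space n) \<mu>)"
proof -
  let ?P = "pos_variation (torus_space n) \<mu>" and ?N = "neg_variation (torus_space n) \<mu>"
  have sm: "signed_measure (torus_space n) \<mu>" using pf by (simp add: primal_feasible_def)
  interpret P: finite_measure ?P by (rule finite_measure_pos_variation[OF sm])
  interpret N: finite_measure ?N by (rule finite_measure_neg_variation[OF sm])
  have iP: "integrable ?P (laurent_eval n d f)" and iN: "integrable ?N (laurent_eval n d f)"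
    by (simp_all add: integrable_laurent_eval P.finite_measure_axioms N.finite_measure_axioms)
  have "dual_objective n d \<sigma> f = (\<integral>z. Re (laurent_eval n d f z) \<partial>?P) - (\<integral>z. Re (laurent_eval n d f z) \<partial>?N)"
    unfolding dual_objective_def primal_feasible_integral[OF pf, symmetric] signed_integral_def
    using iP iN by simp
  moreover have "(\<integral>z. 1 - Re (laurent_eval n d f z) \<partial>?P)
      = measure ?P (torus n) - (\<integral>z. Re (laurent_eval n d f z) \<partial>?P)"
    using iP by (subst Bochner_Integration.integral_diff) auto
  moreover have "(\<integral>z. 1 + Re (laurent_eval n d f z) \<partial>?N)
      = measure ?N (torus n) + (\<integral>z. Re (laurent_eval n d f z) \<partial>?N)"
    using iN by (subst Bochner_Integration.integral_add) auto
  ultimately show ?thesis by (simp add: tv_norm_eq[OF sm])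
qed

lemma dual_feasible_bounds:
  assumes "dual_feasible n d f" "z \<in> torus n"
  shows "0 \<le> 1 - Re (laurent_eval n d f z)" "0 \<le> 1 + Re (laurent_eval n d f z)"
proof -
  have "\<bar>Re (laurent_eval n d f z)\<bar> \<le> 1" using assms by (simp add: dual_feasible_def)
  then show "0 \<le> 1 - Re (laurent_eval n d f z)" "0 \<le> 1 + Re (laurent_eval n d f z)"
    by linarith+
qed

lemma weak_duality:
  assumes pf: "primal_feasible n d \<sigma> \<mu>" and df: "dual_feasible n d f"
  shows "dual_objective n d \<sigma> f \<le> tv_norm (torus_space n) \<mu>"
proof -
  have "0 \<le> (\<integral>z. 1 - Re (laurent_eval n d f z) \<partial>pos_variation (torus_space n) \<mu>)"
    "0 \<le> (\<integral>z. 1 + Re (laurent_eval n d f z) \<partial>neg_variation (torus_space n) \<mu>)"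
    by (intro integral_nonneg_AE AE_I2 dual_feasible_bounds[OF df]; simp)+
  then show ?thesis using duality_gap[OF pf, of f] by linarith
qed

text \<open>A zero gap makes two nonnegative integrals vanish, so the real part of \<open>f\<close>
  is 1 almost everywhere for the positive variation and -1 for the negative one;
  \<open>strict\<close> excludes both values off \<open>\<Xi>\<close>.\<close>

lemma complementary_slackness:
  assumes pf: "primal_feasible n d \<sigma> \<mu>" and df: "dual_feasible n d f"
    and strict: "\<forall>z\<in>torus n - \<Xi>. \<bar>Re (laurent_eval n d f z)\<bar> < 1"
    and opt: "tv_norm (torus_space n) \<mu> = dual_objective n d \<sigma> f"
  shows "AE z in pos_variation (torus_space n) \<mu>. z \<in> \<Xi>"
    and "AE z in neg_variation (torus_space n) \<mu>. z \<in> \<Xi>"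
proof -
  let ?P = "pos_variation (torus_space n) \<mu>" and ?N = "neg_variation (torus_space n) \<mu>"
  let ?F = "\<lambda>z. Re (laurent_eval n d f z)"
  have sm: "signed_measure (torus_space n) \<mu>" using pf by (simp add: primal_feasible_def)
  interpret P: finite_measure ?P by (rule finite_measure_pos_variation[OF sm])
  interpret N: finite_measure ?N by (rule finite_measure_neg_variation[OF sm])
  have iP: "integrable ?P (\<lambda>z. 1 - ?F z)" and iN: "integrable ?N (\<lambda>z. 1 + ?F z)"
    using integrable_laurent_eval(1)[OF P.finite_measure_axioms sets_pos_variation]
      integrable_laurent_eval(1)[OF N.finite_measure_axioms sets_neg_variation] by auto
  have nP: "AE z in ?P. 0 \<le> 1 - ?F z" and nN: "AE z in ?N. 0 \<le> 1 + ?F z"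
    by (intro AE_I2 dual_feasible_bounds[OF df]; simp)+
  have "0 \<le> (\<integral>z. 1 - ?F z \<partial>?P)" "0 \<le> (\<integral>z. 1 + ?F z \<partial>?N)"
    using nP nN by (auto intro: integral_nonneg_AE)
  then have "(\<integral>z. 1 - ?F z \<partial>?P) = 0" "(\<integral>z. 1 + ?F z \<partial>?N) = 0"
    using duality_gap[OF pf, of f] opt by linarith+
  then have z: "AE z in ?P. 1 - ?F z = 0" "AE z in ?N. 1 + ?F z = 0"
    using integral_nonneg_eq_0_iff_AE[OF iP nP] integral_nonneg_eq_0_iff_AE[OF iN nN] by auto
  show "AE z in ?P. z \<in> \<Xi>"
    using z(1) AE_space by eventually_elim (use strict in force)
  show "AE z in ?N. z \<in> \<Xi>"
    using z(2) AE_space by eventually_elim (use strict in force)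
qed

text \<open>The integral formula for atoms is applied to the indicator of \<open>A\<close>, made
  complex to fit \<open>signed_integral\<close>.\<close>

lemma signed_measure_atoms:
  assumes sm: "signed_measure M \<nu>" and \<Xi>: "finite \<Xi>" "\<And>\<xi>. \<xi> \<in> \<Xi> \<Longrightarrow> {\<xi>} \<in> sets M"
    and P: "AE x in pos_variation M \<nu>. x \<in> \<Xi>" and N: "AE x in neg_variation M \<nu>. x \<in> \<Xi>"
    and A: "A \<in> sets M"
  shows "\<nu> A = (\<Sum>\<xi>\<in>\<Xi>. indicator A \<xi> * \<nu> {\<xi>})"
proof -
  have "signed_integral M \<nu> (\<lambda>x. of_real (indicator A x)) = of_real (\<nu> A)"
    using A sets.sets_into_space[OF A]
    by (simp add: signed_integral_def jordan_decomposition[OF sm A] Int_absorb2)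
  moreover have "signed_integral M \<nu> (\<lambda>x. of_real (indicator A x))
      = (\<Sum>\<xi>\<in>\<Xi>. of_real (indicator A \<xi>) * of_real (\<nu> {\<xi>}))"
    using A by (intro signed_integral_atoms[OF sm \<Xi> P N] borel_measurable_of_real) auto
  ultimately have "complex_of_real (\<nu> A) = of_real (\<Sum>\<xi>\<in>\<Xi>. indicator A \<xi> * \<nu> {\<xi>})"
    by simp
  then show ?thesis by (simp only: of_real_eq_iff)
qed

text \<open>Raising \<open>\<phi>\<close> to \<alpha> and then to \<beta> is the same as in the
  other order. This symmetry turns evaluations of the polynomial at powers of \<open>\<phi>\<close>
  into moments of a discrete measure.\<close>

lemma moments_eq:
  "moments n \<phi> g \<alpha> = (\<Sum>\<beta>\<in>coeff_support g. of_real (g \<beta>) * monom n (ptpow n \<phi> (int \<circ> \<beta>)) \<alpha>)"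
  unfolding moments_def poly_eval_def monom_def ptpow_def
  by (intro sum.cong prod.cong arg_cong2[of _ _ _ _ "(*)"] refl)
    (simp add: power_int_power power_int_power' mult.commute)

lemma sums_indicator_disjoint:
  fixes A :: "nat \<Rightarrow> 'a set" and c :: real
  assumes "disjoint_family A"
  shows "(\<lambda>i. if x \<in> A i then c else 0) sums (if x \<in> (\<Union>i. A i) then c else 0)"
proof (cases "x \<in> (\<Union>i. A i)")
  case True
  then obtain j where j: "x \<in> A j" by blast
  then have "x \<in> A i \<longleftrightarrow> i = j" for i
    using disjoint_family_onD[OF assms, of i j] by auto
  then show ?thesis using sums_single[of j "\<lambda>_. c"] by auto
qed auto

section \<open>Recovery of the discrete measure with weights \<open>g\<close>\<close>

lemma signed_measure_dirac_comb: "signed_measure (torus_space n) (dirac_comb n \<phi> g)"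
  unfolding signed_measure_def
proof (intro conjI allI impI)
  fix A :: "nat \<Rightarrow> (nat \<Rightarrow> complex) set"
  assume A: "range A \<subseteq> sets (torus_space n)" "disjoint_family A"
  have "A i \<in> sets (torus_space n)" for i using A(1) by blast
  moreover have "(\<Union>i. A i) \<in> sets (torus_space n)" using A(1) by (rule sets.countable_UN)
  ultimately show "(\<lambda>i. dirac_comb n \<phi> g (A i)) sums dirac_comb n \<phi> g (\<Union>i. A i)"
    unfolding dirac_comb_def using sums_sum[OF sums_indicator_disjoint[OF A(2)]] by simp
qed (auto simp: dirac_comb_def)

text \<open>Recovery relies on \<open>\<phi>\<close> only through distinctness of the nodes and
  their position on the torus; both admissible forms of \<open>\<phi>\<close> are reduced to this at
  the end.\<close>

locale sparse_nodes =
  fixes n :: nat and \<phi> :: "nat \<Rightarrow> complex" and g :: "(nat \<Rightarrow> nat) \<Rightarrow> real"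
  assumes fin: "finite (coeff_support g)"
    and inj: "inj_on (\<lambda>\<beta>. ptpow n \<phi> (int \<circ> \<beta>)) (coeff_support g)"
    and torus: "\<And>\<beta>. ptpow n \<phi> (int \<circ> \<beta>) \<in> torus n"
begin

abbreviation "node \<beta> \<equiv> ptpow n \<phi> (int \<circ> \<beta>)"
abbreviation "nodes \<equiv> node ` coeff_support g"

lemma nodes_finite: "finite nodes" and nodes_torus: "nodes \<subseteq> torus n"
  and nodes_sets: "\<xi> \<in> nodes \<Longrightarrow> {\<xi>} \<in> sets (torus_space n)"
  using fin torus by (auto intro: singleton_sets_torus_space)

text \<open>Injectivity prevents the weights of different exponents from merging at one
  node.\<close>

lemma dirac_comb_node:
  assumes "\<beta> \<in> coeff_support g"
  shows "dirac_comb n \<phi> g {node \<beta>} = g \<beta>"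
proof -
  have "dirac_comb n \<phi> g {node \<beta>} = (\<Sum>\<gamma>\<in>coeff_support g. if \<gamma> = \<beta> then g \<gamma> else 0)"
    unfolding dirac_comb_def using singleton_sets_torus_space[OF torus] inj_onD[OF inj _ _ assms]
    by (auto intro!: sum.cong)
  then show ?thesis using assms fin by simp
qed

lemma dirac_comb_null:
  assumes "B \<inter> nodes = {}"
  shows "dirac_comb n \<phi> g B = 0"
proof -
  have "node \<beta> \<notin> B" if "\<beta> \<in> coeff_support g" for \<beta> using assms that by blast
  then show ?thesis by (simp add: dirac_comb_def)
qed

text \<open>Every subset of the complement of the nodes has value 0, so both suprema defining the
  variations vanish there.\<close>

lemma dirac_comb_AE:
  "AE z in pos_variation (torus_space n) (dirac_comb n \<phi> g). z \<in> nodes"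
  "AE z in neg_variation (torus_space n) (dirac_comb n \<phi> g). z \<in> nodes"
proof -
  let ?\<nu> = "dirac_comb n \<phi> g"
  note sm = signed_measure_dirac_comb[of n \<phi> g]
  have "nodes \<in> sets (torus_space n)"
    using nodes_finite nodes_sets by (rule finite_in_sets)
  then have s: "torus n - nodes \<in> sets (torus_space n)"
    using sets.compl_sets[of nodes "torus_space n"] by simp
  have null: "?\<nu> B = 0" if "B \<subseteq> torus n - nodes" for B
    using that by (intro dirac_comb_null) blast
  have "upper_var (torus_space n) ?\<nu> (torus n - nodes) = 0"
    by (rule antisym[OF upper_var_le upper_var_nonneg[OF sm]]) (simp add: null)
  moreover have "upper_var (torus_space n) (\<lambda>A. - ?\<nu> A) (torus n - nodes) = 0"
    by (rule antisym[OF upper_var_le upper_var_nonneg[OF signed_measure_uminus[OF sm]]])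
      (simp add: null)
  ultimately have "measure (pos_variation (torus_space n) ?\<nu>) (torus n - nodes) = 0"
    "measure (neg_variation (torus_space n) ?\<nu>) (torus n - nodes) = 0"
    by (simp_all add: measure_pos_variation[OF sm s] measure_neg_variation[OF sm s])
  then show "AE z in pos_variation (torus_space n) ?\<nu>. z \<in> nodes"
    "AE z in neg_variation (torus_space n) ?\<nu>. z \<in> nodes"
    using null_off_atoms[OF finite_measure_pos_variation[OF sm] nodes_finite]
      null_off_atoms[OF finite_measure_neg_variation[OF sm] nodes_finite] nodes_sets
    by simp_all
qed

lemma dirac_comb_feasible: "primal_feasible n d (moments n \<phi> g) (dirac_comb n \<phi> g)"
  unfolding primal_feasible_def
proof (intro conjI ballI)
  fix \<alpha>
  have "signed_integral (torus_space n) (dirac_comb n \<phi> g) (\<lambda>z. monom n z \<alpha>)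
      = (\<Sum>\<xi>\<in>nodes. monom n \<xi> \<alpha> * of_real (dirac_comb n \<phi> g {\<xi>}))"
    by (rule signed_integral_atoms[OF signed_measure_dirac_comb nodes_finite nodes_sets dirac_comb_AE
        measurable_monom])
  also have "\<dots> = moments n \<phi> g \<alpha>"
    by (simp add: sum.reindex[OF inj] dirac_comb_node moments_eq mult.commute)
  finally show "signed_integral (torus_space n) (dirac_comb n \<phi> g) (\<lambda>z. monom n z \<alpha>) = moments n \<phi> g \<alpha>" .
qed (rule signed_measure_dirac_comb)

text \<open>A node lies in at most one member of a disjoint family, so after exchanging the sums
  each weight is counted at most once. The reverse inequality will come from weak duality.\<close>

lemma tv_norm_dirac_comb_le: "tv_norm (torus_space n) (dirac_comb n \<phi> g) \<le> (\<Sum>\<beta>\<in>coeff_support g. \<bar>g \<beta>\<bar>)"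
  unfolding tv_norm_def
proof (rule cSUP_least)
  fix Q assume Q: "Q \<in> {P. finite P \<and> P \<subseteq> sets (torus_space n) \<and> disjoint P}"
  have one: "(\<Sum>A\<in>Q. if x \<in> A then \<bar>c\<bar> else 0) \<le> \<bar>c\<bar>" for x :: "nat \<Rightarrow> complex" and c :: real
  proof (cases "\<exists>A\<in>Q. x \<in> A")
    case True
    then obtain A where A: "A \<in> Q" "x \<in> A" by blast
    then have "x \<in> B \<longleftrightarrow> B = A" if "B \<in> Q" for B
      using Q that by (auto simp: disjoint_def)
    then have "(\<Sum>B\<in>Q. if x \<in> B then \<bar>c\<bar> else 0) = (\<Sum>B\<in>Q. if B = A then \<bar>c\<bar> else 0)"
      by (intro sum.cong) auto
    then show ?thesis using Q A by simp
  next
    case False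
    then have "(\<Sum>A\<in>Q. if x \<in> A then \<bar>c\<bar> else 0) = 0" by (intro sum.neutral) auto
    then show ?thesis by simp
  qed
  have "(\<Sum>A\<in>Q. \<bar>dirac_comb n \<phi> g A\<bar>) \<le> (\<Sum>A\<in>Q. \<Sum>\<beta>\<in>coeff_support g. if node \<beta> \<in> A then \<bar>g \<beta>\<bar> else 0)"
    unfolding dirac_comb_def by (intro sum_mono) (auto intro!: order_trans[OF sum_abs] sum_mono sum_nonneg)
  also have "\<dots> = (\<Sum>\<beta>\<in>coeff_support g. \<Sum>A\<in>Q. if node \<beta> \<in> A then \<bar>g \<beta>\<bar> else 0)"
    by (rule sum.swap)
  also have "\<dots> \<le> (\<Sum>\<beta>\<in>coeff_support g. \<bar>g \<beta>\<bar>)" by (intro sum_mono one)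
  finally show "(\<Sum>A\<in>Q. \<bar>dirac_comb n \<phi> g A\<bar>) \<le> (\<Sum>\<beta>\<in>coeff_support g. \<bar>g \<beta>\<bar>)" .
qed (auto intro: exI[of _ "{}"])

lemma dual_objective_moments:
  "dual_objective n d (moments n \<phi> g) f
    = (\<Sum>\<beta>\<in>coeff_support g. g \<beta> * Re (laurent_eval n d f (node \<beta>)))"
proof -
  have "(\<Sum>\<alpha>\<in>A1 n d. moments n \<phi> g \<alpha> * f \<alpha>)
      = (\<Sum>\<beta>\<in>coeff_support g. of_real (g \<beta>) * laurent_eval n d f (node \<beta>))"
    unfolding moments_eq laurent_eval_def sum_distrib_right sum_distrib_left
    by (subst sum.swap) (simp add: mult_ac)
  then show ?thesis by (simp add: dual_objective_def)
qed

text \<open>For a feasible measure carried by the nodes, the weight at \<open>\<xi>\<close> is the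
  integral of \<open>u \<xi>\<close>, a fixed combination of the prescribed moments. Hence
  \<open>\<mu>\<close> and the Dirac comb have the same weights.\<close>

lemma feasible_unique:
  assumes pf: "primal_feasible n d (moments n \<phi> g) \<mu>"
    and ae: "AE z in pos_variation (torus_space n) \<mu>. z \<in> nodes"
      "AE z in neg_variation (torus_space n) \<mu>. z \<in> nodes"
    and u: "\<forall>\<xi>\<in>nodes. \<forall>\<eta>\<in>nodes. laurent_eval n d (u \<xi>) \<eta> = (if \<xi> = \<eta> then 1 else 0)"
  shows "\<mu> = dirac_comb n \<phi> g"
proof
  fix A
  let ?\<nu> = "dirac_comb n \<phi> g" and ?\<sigma> = "moments n \<phi> g"
  have sm: "signed_measure (torus_space n) \<mu>" using pf by (simp add: primal_feasible_def)
  have val: "of_real (\<kappa> {\<xi>}) = (\<Sum>\<alpha>\<in>A1 n d. ?\<sigma> \<alpha> * u \<xi> \<alpha>)"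
    if "\<xi> \<in> nodes" "primal_feasible n d ?\<sigma> \<kappa>"
      "AE z in pos_variation (torus_space n) \<kappa>. z \<in> nodes"
      "AE z in neg_variation (torus_space n) \<kappa>. z \<in> nodes" for \<xi> \<kappa>
  proof -
    have "signed_integral (torus_space n) \<kappa> (laurent_eval n d (u \<xi>))
        = (\<Sum>\<eta>\<in>nodes. laurent_eval n d (u \<xi>) \<eta> * of_real (\<kappa> {\<eta>}))"
      using that(2) by (intro signed_integral_atoms[OF _ nodes_finite nodes_sets that(3,4)]
          measurable_laurent_eval) (simp_all add: primal_feasible_def)
    also have "\<dots> = (\<Sum>\<eta>\<in>nodes. if \<eta> = \<xi> then of_real (\<kappa> {\<eta>}) else 0)"
      using u that(1) by (intro sum.cong) auto
    also have "\<dots> = of_real (\<kappa> {\<xi>})"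
      using that(1) nodes_finite by (subst sum.delta) simp_all
    finally show ?thesis using primal_feasible_integral[OF that(2)] by simp
  qed
  have "complex_of_real (\<mu> {\<xi>}) = of_real (?\<nu> {\<xi>})" if "\<xi> \<in> nodes" for \<xi>
    using val[OF that pf ae] val[OF that dirac_comb_feasible dirac_comb_AE] by simp
  then have eq: "\<mu> {\<xi>} = ?\<nu> {\<xi>}" if "\<xi> \<in> nodes" for \<xi>
    using that by (simp only: of_real_eq_iff)
  show "\<mu> A = ?\<nu> A"
  proof (cases "A \<in> sets (torus_space n)")
    case True
    have "\<mu> A = (\<Sum>\<xi>\<in>nodes. indicator A \<xi> * \<mu> {\<xi>})"
      by (rule signed_measure_atoms[OF sm nodes_finite nodes_sets ae True])
    also have "\<dots> = (\<Sum>\<xi>\<in>nodes. indicator A \<xi> * ?\<nu> {\<xi>})"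
      by (intro sum.cong refl) (simp only: eq)
    also have "\<dots> = ?\<nu> A"
      by (rule signed_measure_atoms[OF signed_measure_dirac_comb nodes_finite nodes_sets
            dirac_comb_AE True, symmetric])
    finally show ?thesis .
  next
    \<comment> \<open>Both set functions are 0 by convention outside the sigma-algebra, so they are
      equal as functions.\<close>
    case False
    then show ?thesis using sm by (simp add: signed_measure_def dirac_comb_def)
  qed
qed

text \<open>The sum of the \<open>\<bar>g \<beta>\<bar>\<close> is the dual objective of the
  certificate, which weak duality bounds by the norm of \<open>muS\<close>, which is in turn at most
  that sum. All are therefore equal, and both problems attain this common value. Uniqueness combines
  slackness with \<open>feasible_unique\<close>.\<close>

lemma recovery:
  fixes d :: nat
  defines "\<sigma> \<equiv> moments n \<phi> g" and "muS \<equiv> dirac_comb n \<phi> g"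
  assumes d: "real d \<ge> (18 * (real (card (coeff_support g)))\<^sup>2 + 2 * real (card (coeff_support g)) + 1)
      * interp_entropy n nodes"
  shows "primal_feasible n d \<sigma> muS"
    and "tv_norm (torus_space n) muS = primal_value n d \<sigma>"
    and "primal_feasible n d \<sigma> \<mu> \<Longrightarrow> tv_norm (torus_space n) muS \<le> tv_norm (torus_space n) \<mu>"
    and "primal_feasible n d \<sigma> \<mu> \<Longrightarrow> tv_norm (torus_space n) \<mu> = primal_value n d \<sigma> \<Longrightarrow> \<mu> = muS"
    and "tv_norm (torus_space n) muS = (\<Sum>\<beta>\<in>coeff_support g. \<bar>g \<beta>\<bar>)"
    and "primal_value n d \<sigma> = dual_value n d \<sigma>"
    and "\<exists>f. dual_feasible n d f \<and> dual_objective n d \<sigma> f = dual_value n d \<sigma> \<and>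
             (\<forall>\<beta>\<in>coeff_support g.
                (g \<beta> > 0 \<longrightarrow> Re (laurent_eval n d f (node \<beta>)) = 1) \<and>
                (g \<beta> < 0 \<longrightarrow> Re (laurent_eval n d f (node \<beta>)) = -1))"
proof -
  \<comment> \<open>The certificate wants signs indexed by points, so the exponent is recovered from
    its node.\<close>
  define \<epsilon> where "\<epsilon> = (\<lambda>\<xi>. sgn (g (the_inv_into (coeff_support g) node \<xi>)))"
  have \<epsilon>: "\<epsilon> (node \<beta>) = sgn (g \<beta>)" if "\<beta> \<in> coeff_support g" for \<beta>
    using the_inv_into_f_f[OF inj that] by (simp add: \<epsilon>_def)
  have \<epsilon>01: "\<epsilon> \<xi> \<in> {1, -1}" if xi: "\<xi> \<in> nodes" for \<xi>
  proof -
    obtain \<beta> where "\<xi> = node \<beta>" "\<beta> \<in> coeff_support g" using xi by blast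
    then show ?thesis using \<epsilon>[of \<beta>] by (simp add: coeff_support_def sgn_if)
  qed
  have card: "card nodes = card (coeff_support g)" by (rule card_image[OF inj])
  obtain f u where f: "dual_feasible n d f"
    and fv: "\<forall>\<xi>\<in>nodes. Re (laurent_eval n d f \<xi>) = \<epsilon> \<xi>"
    and strict: "\<forall>z\<in>torus n - nodes. \<bar>Re (laurent_eval n d f z)\<bar> < 1"
    and u: "\<forall>\<xi>\<in>nodes. \<forall>\<eta>\<in>nodes. laurent_eval n d (u \<xi>) \<eta> = (if \<xi> = \<eta> then 1 else 0)"
    by (rule dual_certificate[OF nodes_finite nodes_torus \<epsilon>01 d[folded card]])
  have fn: "Re (laurent_eval n d f (node \<beta>)) = sgn (g \<beta>)" if "\<beta> \<in> coeff_support g" for \<beta>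
    using fv \<epsilon> that by simp
  have obj: "dual_objective n d \<sigma> f = (\<Sum>\<beta>\<in>coeff_support g. \<bar>g \<beta>\<bar>)"
    unfolding \<sigma>_def dual_objective_moments by (intro sum.cong) (simp_all add: fn abs_sgn)
  show feas: "primal_feasible n d \<sigma> muS" unfolding \<sigma>_def muS_def by (rule dirac_comb_feasible)
  show tv: "tv_norm (torus_space n) muS = (\<Sum>\<beta>\<in>coeff_support g. \<bar>g \<beta>\<bar>)"
    using weak_duality[OF feas f] obj tv_norm_dirac_comb_le unfolding muS_def by linarith
  have min: "tv_norm (torus_space n) muS \<le> tv_norm (torus_space n) \<mu>"
    if "primal_feasible n d \<sigma> \<mu>" for \<mu>
    using weak_duality[OF that f] obj tv by simp
  then show "primal_feasible n d \<sigma> \<mu> \<Longrightarrow> tv_norm (torus_space n) muS \<le> tv_norm (torus_space n) \<mu>" .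
  have pv: "primal_value n d \<sigma> = tv_norm (torus_space n) muS"
    unfolding primal_value_def using feas min by (intro cInf_eq_minimum) auto
  then show "tv_norm (torus_space n) muS = primal_value n d \<sigma>" by simp
  have dv: "dual_value n d \<sigma> = dual_objective n d \<sigma> f"
    unfolding dual_value_def
  proof (rule cSup_eq_maximum)
    show "dual_objective n d \<sigma> f \<in> {dual_objective n d \<sigma> f | f. dual_feasible n d f}"
      using f by blast
    show "x \<le> dual_objective n d \<sigma> f" if "x \<in> {dual_objective n d \<sigma> f | f. dual_feasible n d f}" for x
      using that weak_duality[OF feas] obj tv by auto
  qed
  show "primal_value n d \<sigma> = dual_value n d \<sigma>" using pv dv obj tv by simp
  show "\<exists>f. dual_feasible n d f \<and> dual_objective n d \<sigma> f = dual_value n d \<sigma> \<and>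
             (\<forall>\<beta>\<in>coeff_support g.
                (g \<beta> > 0 \<longrightarrow> Re (laurent_eval n d f (node \<beta>)) = 1) \<and>
                (g \<beta> < 0 \<longrightarrow> Re (laurent_eval n d f (node \<beta>)) = -1))"
    using f dv fn by (intro exI[of _ f]) auto
  assume pf: "primal_feasible n d \<sigma> \<mu>" and "tv_norm (torus_space n) \<mu> = primal_value n d \<sigma>"
  then have "tv_norm (torus_space n) \<mu> = dual_objective n d \<sigma> f" using pv tv obj by simp
  note slack = complementary_slackness[OF pf f strict this]
  show "\<mu> = muS"
    unfolding muS_def by (rule feasible_unique[OF pf[unfolded \<sigma>_def] slack u])
qed

end

section \<open>The two admissible forms of \<open>\<phi>\<close>\<close>

lemma ptpow_torus:
  assumes "\<And>i. i < n \<Longrightarrow> cmod (\<phi> i) = 1"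
  shows "ptpow n \<phi> \<alpha> \<in> torus n"
  using assms by (auto simp: torus_def ptpow_def norm_power_int)

text \<open>Powers of a primitive N-th root of unity determine the exponent modulo N, and exponents
  below N are their own residues.\<close>

lemma inj_on_ptpow_root_of_unity:
  assumes "N > 0" "\<Gamma> \<subseteq> nmultiidx n" "\<And>\<beta> i. \<beta> \<in> \<Gamma> \<Longrightarrow> i < n \<Longrightarrow> \<beta> i < N"
    and \<phi>: "\<And>i. i < n \<Longrightarrow> \<phi> i = exp (2 * of_real pi * \<i> / of_nat N)"
  shows "inj_on (\<lambda>\<beta>. ptpow n \<phi> (int \<circ> \<beta>)) \<Gamma>"
proof (rule inj_onI, rule ext)
  fix \<beta> \<gamma> i
  assume b: "\<beta> \<in> \<Gamma>" "\<gamma> \<in> \<Gamma>" and eq: "ptpow n \<phi> (int \<circ> \<beta>) = ptpow n \<phi> (int \<circ> \<gamma>)"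
  show "\<beta> i = \<gamma> i"
  proof (cases "i < n")
    case True
    have e: "\<phi> i ^ k = exp (2 * of_real pi * \<i> * of_nat k / of_nat N)" for k
      unfolding \<phi>[OF True] exp_of_nat_mult[symmetric] by (simp add: mult_ac)
    have "\<phi> i ^ \<beta> i = \<phi> i ^ \<gamma> i"
      using fun_cong[OF eq, of i] True by (simp add: ptpow_def)
    then have "\<beta> i mod N = \<gamma> i mod N"
      unfolding e using complex_root_unity_eq[of N "\<beta> i" "\<gamma> i"] assms(1) by simp
    then show ?thesis using assms(3)[OF _ True] b by simp
  next
    case False
    then have "\<beta> i = 0" "\<gamma> i = 0" using assms(2) b by (auto simp: nmultiidx_def)
    then show ?thesis by simp
  qed
qed

theorem theorem3p5:
  "\<forall>r::nat. \<exists>C::real. C > 0 \<and>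
    (\<forall>(n::nat) (g::(nat \<Rightarrow> nat) \<Rightarrow> real) (\<phi>::nat \<Rightarrow> complex) (d::nat).
      finite (coeff_support g) \<and> coeff_support g \<subseteq> nmultiidx n \<and>
      card (coeff_support g) = r \<and>
      ((\<exists>N::nat. N > 0 \<and> (\<forall>\<beta>\<in>coeff_support g. \<forall>i<n. \<beta> i < N) \<and>
           \<phi> = (\<lambda>i. if i < n then exp (2 * pi * \<i> / of_nat N) else 0)) \<or>
       (\<exists>\<theta>::nat \<Rightarrow> real. (\<forall>i<n. \<theta> i \<notin> \<nat>) \<and>
           \<phi> = (\<lambda>i. if i < n then exp (2 * pi * \<i> * complex_of_real (\<theta> i)) else 0) \<and>
           (\<forall>\<alpha>\<in>zmultiidx n. \<forall>\<beta>\<in>zmultiidx n. \<alpha> \<noteq> \<beta> \<longrightarrow> ptpow n \<phi> \<alpha> \<noteq> ptpow n \<phi> \<beta>))) \<and>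
      real d \<ge> C * interp_entropy n ((\<lambda>\<beta>. ptpow n \<phi> (int \<circ> \<beta>)) ` coeff_support g)
      \<longrightarrow>
      (let \<sigma> = moments n \<phi> g; muS = dirac_comb n \<phi> g in
        primal_feasible n d \<sigma> muS \<and>
        tv_norm (torus_space n) muS = primal_value n d \<sigma> \<and>
        (\<forall>\<mu>. primal_feasible n d \<sigma> \<mu> \<longrightarrow> tv_norm (torus_space n) muS \<le> tv_norm (torus_space n) \<mu>) \<and>
        (\<forall>\<mu>. primal_feasible n d \<sigma> \<mu> \<and> tv_norm (torus_space n) \<mu> = primal_value n d \<sigma> \<longrightarrow> \<mu> = muS) \<and>
        tv_norm (torus_space n) muS = (\<Sum>\<beta>\<in>coeff_support g. \<bar>g \<beta>\<bar>) \<and>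
        primal_value n d \<sigma> = dual_value n d \<sigma> \<and>
        (\<exists>f. dual_feasible n d f \<and> dual_objective n d \<sigma> f = dual_value n d \<sigma> \<and>
             (\<forall>\<beta>\<in>coeff_support g.
                (g \<beta> > 0 \<longrightarrow> Re (laurent_eval n d f (ptpow n \<phi> (int \<circ> \<beta>))) = 1) \<and>
                (g \<beta> < 0 \<longrightarrow> Re (laurent_eval n d f (ptpow n \<phi> (int \<circ> \<beta>))) = -1)))))"
proof (rule allI, rule_tac x = "18 * (real r)\<^sup>2 + 2 * real r + 1" in exI, intro conjI allI impI, goal_cases)
  case (1 r)
  \<comment> \<open>The summand 1 keeps the constant positive for r = 0.\<close>
  then show ?case by (simp add: add_nonneg_pos)
next
  case (2 r n g \<phi> d)
  have fin: "finite (coeff_support g)" and sub: "coeff_support g \<subseteq> nmultiidx n"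
    and card: "card (coeff_support g) = r"
    and d: "real d \<ge> (18 * (real r)\<^sup>2 + 2 * real r + 1)
        * interp_entropy n ((\<lambda>\<beta>. ptpow n \<phi> (int \<circ> \<beta>)) ` coeff_support g)"
    by (rule 2[THEN conjunct1], rule 2[THEN conjunct2, THEN conjunct1],
        rule 2[THEN conjunct2, THEN conjunct2, THEN conjunct1],
        rule 2[THEN conjunct2, THEN conjunct2, THEN conjunct2, THEN conjunct2])
  have *: "inj_on (\<lambda>\<beta>. ptpow n \<phi> (int \<circ> \<beta>)) (coeff_support g) \<and> (\<forall>i<n. cmod (\<phi> i) = 1)"
    using 2[THEN conjunct2, THEN conjunct2, THEN conjunct2, THEN conjunct1]
  proof (elim disjE exE conjE)
    fix N :: nat
    assume N: "N > 0" "\<forall>\<beta>\<in>coeff_support g. \<forall>i<n. \<beta> i < N"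
      and \<phi>: "\<phi> = (\<lambda>i. if i < n then exp (2 * pi * \<i> / of_nat N) else 0)"
    have \<phi>i: "\<phi> i = exp (2 * of_real pi * \<i> / of_nat N)" if "i < n" for i
      using that unfolding \<phi> by simp
    have "cmod (\<phi> i) = 1" if "i < n" for i
      unfolding \<phi>i[OF that] by (simp add: norm_exp_eq_Re)
    moreover have "inj_on (\<lambda>\<beta>. ptpow n \<phi> (int \<circ> \<beta>)) (coeff_support g)"
      by (rule inj_on_ptpow_root_of_unity[OF N(1) sub _ \<phi>i]) (use N(2) in blast)
    ultimately show ?thesis by blast
  next
    fix \<theta> :: "nat \<Rightarrow> real"
    assume \<phi>: "\<phi> = (\<lambda>i. if i < n then exp (2 * pi * \<i> * complex_of_real (\<theta> i)) else 0)"
      and ne: "\<forall>\<alpha>\<in>zmultiidx n. \<forall>\<beta>\<in>zmultiidx n. \<alpha> \<noteq> \<beta> \<longrightarrow> ptpow n \<phi> \<alpha> \<noteq> ptpow n \<phi> \<beta>"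
    have "inj_on (\<lambda>\<beta>. ptpow n \<phi> (int \<circ> \<beta>)) (coeff_support g)"
    proof (rule inj_onI)
      fix \<beta> \<gamma>
      assume b: "\<beta> \<in> coeff_support g" "\<gamma> \<in> coeff_support g"
        and eq: "ptpow n \<phi> (int \<circ> \<beta>) = ptpow n \<phi> (int \<circ> \<gamma>)"
      have "\<beta> \<in> nmultiidx n" "\<gamma> \<in> nmultiidx n" using sub b by blast+
      then have "int \<circ> \<beta> \<in> zmultiidx n" "int \<circ> \<gamma> \<in> zmultiidx n"
        by (simp_all add: nmultiidx_def zmultiidx_def)
      then have "int \<circ> \<beta> = int \<circ> \<gamma>" using ne eq by blast
      then show "\<beta> = \<gamma>" by (simp add: fun_eq_iff)
    qed
    moreover have "cmod (\<phi> i) = 1" if "i < n" for i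
      unfolding \<phi> using that by (simp add: norm_exp_eq_Re)
    ultimately show ?thesis by blast
  qed
  interpret sparse_nodes n \<phi> g
  proof
    show "ptpow n \<phi> (int \<circ> \<beta>) \<in> torus n" for \<beta>
      using * by (intro ptpow_torus) blast
  qed (use fin * in blast)+
  note rec = recovery[of d, unfolded card, OF d]
  show ?case
    unfolding Let_def
    by (intro conjI allI impI, rule rec(1), rule rec(2), erule rec(3), erule conjE, erule rec(4),
        assumption, rule rec(5), rule rec(6), rule rec(7))
qed

end
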